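(* There exist a probability space $(\Omega,\mu)$, an invertible ergodic transformation $T:\Omega\to\Omega$, and a bounded measurable function $f:\Omega\to\mathbb{R}$ such that the associated Lyapunov exponent $L(E)$ vanishes for generic $E\in[-4,4]$, such that $[-4,4]\subseteq\sigma(H_\omega)$ for every $\omega\in\Omega$, and such that, for this same $(\Omega,T,f)$, $L(E)$ is discontinuous on a set of $E$ of positive Lebesgue measure.
   Context: The transformation $T$ is ergodic with respect to $\mu$ (in particular it preserves $\mu$). For $\omega\in\Omega$ put $V_\omega(n)=f(T^n\omega)$, $n\in\mathbb{Z}$. $H_\omega=\Delta+V_\omega$ is the Schrödinger operator on $\ell^2(\mathbb{Z})$, where $(\Delta u)(n)=u(n+1)+u(n-1)$ and $V_\omega$ acts by multiplication; $\sigma(H_\omega)$ is its spectrum. The transfer matrices are $$A_N(E,V_\omega)=\prod_{n=1}^{N}\begin{pmatrix}E-V_\omega(N-n)&-1\\1&0\end{pmatrix}$$ (factors written left to right for $n=1,\dots,N$, so the rightmost factor involves $V_\omega(0)$). The Lyapunov exponent is $$L(E)=\lim_{N\to\infty}\frac1N\int_\Omega\log\|A_N(E,V_\omega)\|\,d\mu(\omega),\qquad E\in\mathbb{R}.$$ "Generic $E\in[-4,4]$" means all $E$ in a set containing a dense $G_\delta$ subset of $[-4,4]$. *)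

theory Defs
  imports "HOL-Probability.Probability"
begin

definition invertible_transformation :: "'a measure \<Rightarrow> ('a \<Rightarrow> 'a) \<Rightarrow> bool" where
  "invertible_transformation M T \<longleftrightarrow>
     bij_betw T (space M) (space M) \<and>
     T \<in> measurable M M \<and> inv_into (space M) T \<in> measurable M M"

definition ergodic_transformation :: "'a measure \<Rightarrow> ('a \<Rightarrow> 'a) \<Rightarrow> bool" where
  "ergodic_transformation M T \<longleftrightarrow>
     T \<in> measurable M M \<and>
     (\<forall>A\<in>sets M. measure M (T -` A \<inter> space M) = measure M A) \<and>
     (\<forall>A\<in>sets M. T -` A \<inter> space M = A \<longrightarrow> measure M A = 0 \<or> measure M A = 1)"

definition int_iterate :: "'a set \<Rightarrow> ('a \<Rightarrow> 'a) \<Rightarrow> int \<Rightarrow> 'a \<Rightarrow> 'a" where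
  "int_iterate X T n = (if 0 \<le> n then T ^^ nat n else inv_into X T ^^ nat (- n))"

definition potential :: "'a measure \<Rightarrow> ('a \<Rightarrow> 'a) \<Rightarrow> ('a \<Rightarrow> real) \<Rightarrow> 'a \<Rightarrow> int \<Rightarrow> real" where
  "potential M T f \<omega> n = f (int_iterate (space M) T n \<omega>)"

text \<open>The space \<open>\<ell>\<^sup>2(\<int>)\<close> is modelled by its carrier set inside the type of all complex sequences.\<close>

definition ell2 :: "(int \<Rightarrow> complex) set" where
  "ell2 = {u. (\<lambda>n. (cmod (u n))\<^sup>2) summable_on UNIV}"

definition ell2_norm :: "(int \<Rightarrow> complex) \<Rightarrow> real" where
  "ell2_norm u = sqrt (\<Sum>\<^sub>\<infinity>n. (cmod (u n))\<^sup>2)"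

definition schroedinger :: "(int \<Rightarrow> real) \<Rightarrow> (int \<Rightarrow> complex) \<Rightarrow> (int \<Rightarrow> complex)" where
  "schroedinger V u n = u (n + 1) + u (n - 1) + of_real (V n) * u n"

text \<open>
  The resolvent set consists of those \<open>z\<close> for which
  \<open>A - z\<close> is a bijection of \<open>\<ell>\<^sup>2(\<int>)\<close> whose inverse is bounded.
\<close>

definition ell2_resolvent_set :: "((int \<Rightarrow> complex) \<Rightarrow> (int \<Rightarrow> complex)) \<Rightarrow> complex set" where
  "ell2_resolvent_set A =
     {z. bij_betw (\<lambda>u n. A u n - z * u n) ell2 ell2 \<and>
         (\<exists>C. \<forall>v\<in>ell2. ell2_norm (inv_into ell2 (\<lambda>u n. A u n - z * u n) v) \<le> C * ell2_norm v)}"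

definition ell2_spectrum :: "((int \<Rightarrow> complex) \<Rightarrow> (int \<Rightarrow> complex)) \<Rightarrow> complex set" where
  "ell2_spectrum A = - ell2_resolvent_set A"

definition one_step_matrix :: "real \<Rightarrow> real \<Rightarrow> real^2^2" where
  "one_step_matrix E v = vector [vector [E - v, -1], vector [1, 0]]"

text \<open>The list below is ordered so that the leftmost factor of the product involves \<open>V (N - 1)\<close>
  and the rightmost one \<open>V 0\<close>.\<close>

definition transfer_matrix :: "nat \<Rightarrow> real \<Rightarrow> (int \<Rightarrow> real) \<Rightarrow> real^2^2" where
  "transfer_matrix N E V =
     foldr (**) (map (\<lambda>n. one_step_matrix E (V (int N - int n))) [1..<Suc N]) (mat 1)"

text \<open>The limit exists for every \<open>E\<close>, by subadditivity, whenever \<open>T\<close> preserves the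
  probability measure \<open>M\<close> and \<open>f\<close> is bounded and measurable.\<close>

definition lyapunov :: "'a measure \<Rightarrow> ('a \<Rightarrow> 'a) \<Rightarrow> ('a \<Rightarrow> real) \<Rightarrow> real \<Rightarrow> real" where
  "lyapunov M T f E =
     lim (\<lambda>N. 1 / real N *
       (\<integral>\<omega>. ln (onorm ((*v) (transfer_matrix N E (potential M T f \<omega>)))) \<partial>M))"

definition generically_on :: "'a::topological_space set \<Rightarrow> ('a \<Rightarrow> bool) \<Rightarrow> bool" where
  "generically_on X P \<longleftrightarrow>
     (\<exists>G. gdelta_in (top_of_set X) G \<and> (top_of_set X) closure_of G = X \<and> (\<forall>x\<in>G. P x))"

end

theory Submission
  imports Defs "HOL-Computational_Algebra.Fundamental_Theorem_Algebra" "HOL-Real_Asymp.Real_Asymp"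
begin

text \<open>
  The upper left entry of the \<open>N\<close>-step transfer matrix is a monic polynomial of degree \<open>N\<close> in the
  energy, and the integral of \<open>ln \<bar>E - z\<bar>\<close> over \<open>[-4, 4]\<close> is at least \<open>8 (ln 4 - 1) > 0\<close> for every
  \<open>z\<close>.  Hence the integral of the Lyapunov exponent over \<open>[-4, 4]\<close> is positive for every bounded
  potential, and the exponent is positive on a set of positive measure.  As an infimum of continuous
  functions the exponent is upper semicontinuous, so it vanishes generically as soon as arbitrarily
  small values occur densely; then it is discontinuous wherever it is positive.

  Small values come from a potential over the dyadic odometer that takes the values \<open>2\<close> and \<open>-2\<close>
  and is approximated by periodic potentials \<open>w\<^sub>k\<close>, where \<open>w\<^sub>k\<^sub>+\<^sub>1\<close> arises from \<open>w\<^sub>k\<close> by inserting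
  long patches of \<open>2\<close> and of \<open>-2\<close> once per very long period.  Plane waves on the patches show that
  every energy in \<open>[-4, 4]\<close> is close to an energy with a periodic eigenfunction of \<open>w\<^sub>k\<close>, where the
  transfer matrices of \<open>w\<^sub>k\<close> grow only linearly; the later modifications are too rare to destroy this.
  The same patches put \<open>[-4, 4]\<close> into the spectrum.
\<close>

section \<open>Transfer matrices\<close>

text \<open>Two requirements dictate the letters. A stretch of constant value \<open>c\<close>
  yields the energies \<open>c + 2 cos \<theta>\<close>, an interval of length 4 only, while the
  lower bound \<open>2 r (ln r - 1)\<close> for an interval of radius \<open>r\<close> is positive
  only if \<open>r > exp 1\<close>; so one letter is not enough. The letters \<open>2\<close> and
  \<open>-2\<close> together give \<open>[0, 4]\<close> and \<open>[-4, 0]\<close>, and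
  \<open>4 > exp 1\<close>.

  The obstacle is the order of the choices. How long a window must be before linear growth looks
  slow depends on the period, hence on the word itself; only then can the frequency of later changes
  be limited. Each stage therefore fixes its period, its word, the window length \<open>N\<close>
  and the budget \<open>\<beta>\<close> in this order. A small \<open>N * \<beta>\<close> means that
  most windows of length \<open>N\<close> show an unchanged piece of the word.

  Linear growth needs an energy whose one-period matrix has eigenvalue 1. Such energies come from a
  variational argument on the cycle of periodic sequences, with a truncated plane wave as trial
  function, so no band theory enters.\<close>

lemma onorm_matrix_mult_le:
  fixes A B :: "real^2^2"
  shows "onorm ((*v) (A ** B)) \<le> onorm ((*v) A) * onorm ((*v) B)"
proof -
  have "(*v) (A ** B) = (*v) A \<circ> (*v) B"
    by (auto simp: matrix_vector_mul_assoc)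
  then show ?thesis
    using onorm_compose[of "(*v) A" "(*v) B"] by (simp add: matrix_vector_mul_bounded_linear)
qed

lemma onorm_matrix_add_le:
  fixes A B :: "real^2^2"
  shows "onorm ((*v) (A + B)) \<le> onorm ((*v) A) + onorm ((*v) B)"
proof -
  have "(*v) (A + B) = (\<lambda>x. A *v x + B *v x)"
    by (simp add: fun_eq_iff matrix_vector_mult_add_rdistrib)
  then show ?thesis
    using onorm_triangle[of "(*v) A" "(*v) B"] by (simp add: matrix_vector_mul_bounded_linear)
qed

lemma onorm_matrix_scaleR:
  fixes A :: "real^2^2"
  shows "onorm ((*v) (c *\<^sub>R A)) = \<bar>c\<bar> * onorm ((*v) A)"
proof -
  have "(*v) (c *\<^sub>R A) = (\<lambda>x. c *\<^sub>R (A *v x))"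
    by (simp only: scaleR_matrix_vector_assoc)
  then show ?thesis
    using onorm_scaleR[of "(*v) A" c] by (simp only: matrix_vector_mul_bounded_linear)
qed

lemma onorm_mat_1: "onorm ((*v) (mat 1 :: real^2^2)) = 1"
proof -
  have "(*v) (mat 1 :: real^2^2) = (\<lambda>x. x)" by auto
  then show ?thesis by (simp add: onorm_id)
qed

lemma onorm_matrix_nonneg: "0 \<le> onorm ((*v) (A :: real^2^2))"
  by (simp add: onorm_pos_le matrix_vector_mul_bounded_linear)

text \<open>Lagrange's identity bounds the squared determinant by the product of the squared column
  lengths, and no column is longer than the operator norm. It makes every logarithm of a transfer
  matrix norm nonnegative.\<close>

lemma onorm_ge_1_if_det_1:
  fixes A :: "real^2^2"
  assumes "det A = 1"
  shows "1 \<le> onorm ((*v) A)"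
proof -
  let ?o = "onorm ((*v) A)"
  have col: "norm (column j A) \<le> ?o" for j
    by (rule norm_column_le_onorm)
  have n: "(norm (column j A))\<^sup>2 = (A$1$j)\<^sup>2 + (A$2$j)\<^sup>2" for j
    by (simp add: norm_vec_def L2_set_def sum_2 column_def)
  have "1 = (A$1$1 * A$2$2 - A$1$2 * A$2$1)\<^sup>2" using assms by (simp add: det_2)
  also have "\<dots> = ((A$1$1)\<^sup>2 + (A$2$1)\<^sup>2) * ((A$1$2)\<^sup>2 + (A$2$2)\<^sup>2)
      - (A$1$1 * A$1$2 + A$2$1 * A$2$2)\<^sup>2"
    by (simp add: power2_eq_square algebra_simps)
  also have "\<dots> \<le> (norm (column 1 A))\<^sup>2 * (norm (column 2 A))\<^sup>2"
    by (simp add: n)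
  also have "\<dots> \<le> ?o\<^sup>2 * ?o\<^sup>2"
    by (intro mult_mono power_mono col) auto
  finally have "1 \<le> ?o ^ 4" by (simp add: power4_eq_xxxx power2_eq_square mult.assoc)
  then show ?thesis
    using power_strict_mono[of ?o 1 4] onorm_matrix_nonneg[of A] by force
qed

text \<open>Norms of two matrices differ by at most the sum of the absolute differences of their
  entries.\<close>

lemma continuous_on_onorm_matrix:
  fixes A :: "real \<Rightarrow> real^2^2"
  assumes "\<And>i j. continuous_on S (\<lambda>x. A x $ i $ j)"
  shows "continuous_on S (\<lambda>x. onorm ((*v) (A x)))"
proof -
  have diff: "\<bar>onorm ((*v) B) - onorm ((*v) C)\<bar> \<le> (\<Sum>i\<in>UNIV. \<Sum>j\<in>UNIV. \<bar>B$i$j - C$i$j\<bar>)"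
    for B C :: "real^2^2"
  proof -
    have le: "onorm ((*v) (B - C)) \<le> (\<Sum>i\<in>UNIV. \<Sum>j\<in>UNIV. \<bar>B$i$j - C$i$j\<bar>)" for B C :: "real^2^2"
      using onorm_le_matrix_component_sum[of "B - C"] by simp
    show ?thesis
      using onorm_matrix_add_le[of "B - C" C] onorm_matrix_add_le[of "C - B" B] le[of B C] le[of C B]
      by (simp add: abs_minus_commute)
  qed
  show ?thesis
    unfolding continuous_on_def
  proof
    fix x assume "x \<in> S"
    define g where "g y = (\<Sum>i\<in>UNIV. \<Sum>j\<in>UNIV. \<bar>A y $ i $ j - A x $ i $ j\<bar>)" for y
    have "(g \<longlongrightarrow> (\<Sum>i\<in>(UNIV::2 set). \<Sum>j\<in>(UNIV::2 set). \<bar>A x $ i $ j - A x $ i $ j\<bar>)) (at x within S)"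
      using assms \<open>x \<in> S\<close> unfolding continuous_on_def g_def
      by (intro tendsto_sum tendsto_rabs tendsto_diff tendsto_const) auto
    then have g: "(g \<longlongrightarrow> 0) (at x within S)" by simp
    have "norm (onorm ((*v) (A y)) - onorm ((*v) (A x))) \<le> g y" for y
      unfolding g_def real_norm_def by (rule diff)
    then have "((\<lambda>y. onorm ((*v) (A y)) - onorm ((*v) (A x))) \<longlongrightarrow> 0) (at x within S)"
      using g by (intro Lim_null_comparison[OF always_eventually[OF allI] g])
    then show "((\<lambda>y. onorm ((*v) (A y))) \<longlongrightarrow> onorm ((*v) (A x))) (at x within S)"
      by (rule Lim_null[THEN iffD2])
  qed
qed

lemma one_step_entries [simp]:
  "one_step_matrix E v $ 1 $ 1 = E - v" "one_step_matrix E v $ 1 $ 2 = -1"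
  "one_step_matrix E v $ 2 $ 1 = 1" "one_step_matrix E v $ 2 $ 2 = 0"
  by (simp_all add: one_step_matrix_def)

lemma det_one_step [simp]: "det (one_step_matrix E v) = 1"
  by (simp add: det_2)

lemma onorm_one_step_le: "onorm ((*v) (one_step_matrix E v)) \<le> \<bar>E - v\<bar> + 2"
  using onorm_le_matrix_component_sum[of "one_step_matrix E v"] by (simp add: sum_2)

lemma transfer_matrix_0 [simp]: "transfer_matrix 0 E V = mat 1"
  by (simp add: transfer_matrix_def)

lemma transfer_matrix_Suc:
  "transfer_matrix (Suc N) E V = one_step_matrix E (V (int N)) ** transfer_matrix N E V"
proof -
  \<comment> \<open>The head \<open>1\<close> yields the new site \<open>N\<close>; raising the
    remaining indices by one cancels the growth of \<open>N\<close> in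
    \<open>int N - int n\<close>.\<close>
  have "[1..<Suc (Suc N)] = 1 # map Suc [1..<Suc N]"
    by (simp add: upt_conv_Cons map_Suc_upt del: upt_Suc)
  then show ?thesis
    by (simp add: transfer_matrix_def comp_def del: upt_Suc)
qed

lemma transfer_matrix_add:
  "transfer_matrix (m + n) E V = transfer_matrix m E (\<lambda>i. V (i + int n)) ** transfer_matrix n E V"
  by (induction m) (simp_all add: transfer_matrix_Suc matrix_mul_assoc)

lemma transfer_matrix_cong:
  "(\<And>n. n < N \<Longrightarrow> V (int n) = W (int n)) \<Longrightarrow> transfer_matrix N E V = transfer_matrix N E W"
  by (induction N) (simp_all add: transfer_matrix_Suc)

lemma det_transfer_matrix [simp]: "det (transfer_matrix N E V) = 1"
  by (induction N) (simp_all add: transfer_matrix_Suc det_mul)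

lemma onorm_transfer_matrix_ge_1: "1 \<le> onorm ((*v) (transfer_matrix N E V))"
  by (simp add: onorm_ge_1_if_det_1)

lemma onorm_transfer_matrix_le:
  assumes "\<And>n. n < N \<Longrightarrow> \<bar>E - V (int n)\<bar> + 2 \<le> C"
  shows "onorm ((*v) (transfer_matrix N E V)) \<le> C ^ N"
  using assms
proof (induction N)
  case (Suc N)
  have "onorm ((*v) (transfer_matrix (Suc N) E V))
      \<le> onorm ((*v) (one_step_matrix E (V (int N)))) * onorm ((*v) (transfer_matrix N E V))"
    unfolding transfer_matrix_Suc by (rule onorm_matrix_mult_le)
  also have "\<dots> \<le> C * C ^ N"
    using Suc.IH Suc.prems order_trans[OF onorm_one_step_le Suc.prems[of N]] abs_ge_zero[of "E - V (int N)"]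
    by (intro mult_mono onorm_matrix_nonneg) (force dest: spec[of _ N])+
  finally show ?case by simp
qed (simp add: onorm_mat_1)

lemma continuous_on_onorm_transfer_matrix:
  "continuous_on S (\<lambda>E. onorm ((*v) (transfer_matrix N E V)))"
proof (rule continuous_on_onorm_matrix)
  have "continuous_on S (\<lambda>E. transfer_matrix N E V $ i $ j)" for i j :: 2
  proof (induction N arbitrary: i j)
    case (Suc N)
    consider "i = 1" | "i = 2" using exhaust_2 by blast
    then show ?case
      by cases (auto simp: transfer_matrix_Suc matrix_matrix_mult_def sum_2 intro!: continuous_intros Suc)
  qed simp
  then show "continuous_on S (\<lambda>E. transfer_matrix N E V $ i $ j)" for i j :: 2 .
qed

lemma transfer_matrix_solution:
  assumes "\<And>n. u (n + 1) + u (n - 1) + V n * u n = E * u n"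
  shows "transfer_matrix N E V *v vector [u 0, u (- 1)] = vector [u (int N), u (int N - 1)]"
proof (induction N)
  case (Suc N)
  have "transfer_matrix (Suc N) E V *v vector [u 0, u (- 1)]
      = one_step_matrix E (V (int N)) *v vector [u (int N), u (int N - 1)]"
    by (simp add: transfer_matrix_Suc Suc flip: matrix_vector_mul_assoc)
  also have "\<dots> = vector [u (int (Suc N)), u (int (Suc N) - 1)]"
    using assms[of "int N"]
    by (simp add: vec_eq_iff forall_2 matrix_vector_mult_def sum_2 algebra_simps)
  finally show ?case .
qed simp

text \<open>The lower entry is the upper one of the previous step, so the first column obeys a
  three-term recurrence whose second term has too small a degree to touch the leading coefficient.
  The alternative \<open>r = 0\<close> covers \<open>N = 0\<close>, where no degree is below
  \<open>N\<close>.\<close>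

lemma transfer_matrix_poly:
  "\<exists>p r. degree p = N \<and> lead_coeff p = 1 \<and> (r = 0 \<or> degree r < N) \<and>
     (\<forall>E. transfer_matrix N E V $ 1 $ 1 = poly p E \<and> transfer_matrix N E V $ 2 $ 1 = poly r E)"
proof (induction N)
  case 0
  show ?case by (rule exI[of _ 1], rule exI[of _ 0]) (simp add: mat_def)
next
  case (Suc N)
  then obtain p r where p: "degree p = N" "lead_coeff p = 1" "r = 0 \<or> degree r < N"
    and e: "\<And>E. transfer_matrix N E V $ 1 $ 1 = poly p E" "\<And>E. transfer_matrix N E V $ 2 $ 1 = poly r E"
    by blast
  let ?a = "[:- V (int N), 1:] * p"
  have "p \<noteq> 0" using p by auto
  then have deg: "degree ?a = Suc N" using p by (subst degree_mult_eq) auto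
  have lc: "lead_coeff ?a = 1" using p by (subst lead_coeff_mult) auto
  have ar: "degree r < degree ?a \<or> r = 0" using deg p by auto
  have d: "degree (?a - r) = Suc N"
    using ar deg degree_add_eq_left[of "- r" ?a] by auto
  have "coeff r (Suc N) = 0" using p by (auto intro: coeff_eq_0)
  then have "lead_coeff (?a - r) = 1" using lc by (simp only: d deg coeff_diff)
  moreover have "transfer_matrix (Suc N) E V $ 1 $ 1 = poly (?a - r) E \<and>
      transfer_matrix (Suc N) E V $ 2 $ 1 = poly p E" for E
    by (simp add: transfer_matrix_Suc matrix_matrix_mult_def sum_2 e algebra_simps)
  moreover have "degree p < Suc N" using p by simp
  ultimately show ?case using d by blast
qed

lemma onorm_ge_entry: "\<bar>A $ i $ j\<bar> \<le> onorm ((*v) (A :: real^2^2))"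
  by (rule matrix_component_le_onorm)

section \<open>Logarithmic integrals of monic polynomials\<close>

text \<open>Gives continuity of the antiderivative \<open>t * ln \<bar>t\<bar> - t\<close> across
  the logarithmic singularity.\<close>

lemma mult_ln_abs_tendsto_0: "((\<lambda>t::real. t * ln \<bar>t\<bar>) \<longlongrightarrow> 0) (at 0)"
proof -
  have r: "((\<lambda>t::real. t * ln t) \<longlongrightarrow> 0) (at_right 0)"
    by real_asymp
  have "((\<lambda>t::real. t * ln \<bar>t\<bar>) \<longlongrightarrow> 0) (at_right 0)"
    by (rule Lim_transform_eventually[OF r]) (auto simp: eventually_at_filter)
  moreover have "((\<lambda>t::real. t * ln \<bar>t\<bar>) \<longlongrightarrow> 0) (at_left 0)"
  proof -
    have "((\<lambda>t::real. - (t * ln t)) \<longlongrightarrow> 0) (at_right 0)"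
      using tendsto_minus[OF r] by simp
    then have "((\<lambda>t::real. (-t) * ln \<bar>-t\<bar>) \<longlongrightarrow> 0) (at_right 0)"
      by (rule Lim_transform_eventually) (auto simp: eventually_at_filter)
    then show ?thesis
      by (subst at_left_minus) (simp add: filterlim_filtermap del: abs_minus)
  qed
  ultimately show ?thesis
    by (simp add: filterlim_split_at)
qed

lemma has_integral_ln_abs:
  fixes a :: real
  assumes "l \<le> u"
  shows "((\<lambda>x. ln \<bar>x - a\<bar>) has_integral
    ((u - a) * ln \<bar>u - a\<bar> - (u - a)) - ((l - a) * ln \<bar>l - a\<bar> - (l - a))) {l..u}"
\<comment> \<open>Differentiability may fail at the exceptional point \<open>a\<close>, provided the
  antiderivative is continuous there.\<close>
proof (rule fundamental_theorem_of_calculus_interior_strong[of "{a}"])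
  fix x assume "x \<in> {l<..<u} - {a}"
  then have "x - a > 0 \<or> x - a < 0" by auto
  then have "((\<lambda>x. (x - a) * ln \<bar>x - a\<bar> - (x - a)) has_real_derivative ln \<bar>x - a\<bar>) (at x)"
  proof
    assume x: "x - a > 0"
    have "((\<lambda>x. (x - a) * ln (x - a) - (x - a)) has_real_derivative ln \<bar>x - a\<bar>) (at x)"
      using x by (auto intro!: derivative_eq_intros)
    then show ?thesis
      by (rule has_field_derivative_transform_within_open[of _ _ _ "{a<..}"]) (use x in auto)
  next
    assume x: "x - a < 0"
    have "((\<lambda>x. (x - a) * ln (a - x) - (x - a)) has_real_derivative ln \<bar>x - a\<bar>) (at x)"
      using x by (auto intro!: derivative_eq_intros simp: divide_simps)
    then show ?thesis
      by (rule has_field_derivative_transform_within_open[of _ _ _ "{..<a}"]) (use x in auto)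
  qed
  then show "((\<lambda>x. (x - a) * ln \<bar>x - a\<bar> - (x - a)) has_vector_derivative ln \<bar>x - a\<bar>) (at x)"
    by (simp add: has_real_derivative_iff_has_vector_derivative)
next
  have "isCont (\<lambda>t::real. t * ln \<bar>t\<bar>) t" for t
  proof (cases "t = 0")
    case True then show ?thesis using mult_ln_abs_tendsto_0 by (simp add: isCont_def)
  qed (auto intro!: continuous_intros)
  then have "isCont (\<lambda>x. (x - a) * ln \<bar>x - a\<bar>) x" for x
    using isCont_o2[where f = "\<lambda>x. x - a" and g = "\<lambda>t. t * ln \<bar>t\<bar>" and a = x] by simp
  then show "continuous_on {l..u} (\<lambda>x. (x - a) * ln \<bar>x - a\<bar> - (x - a))"
    by (intro continuous_on_diff continuous_on_id continuous_on_const continuous_at_imp_continuous_on) auto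
qed (use assms in auto)

text \<open>The graph of the convex function \<open>t ln t\<close> lies above its tangent at
  \<open>s\<close>; this is \<open>ln x \<le> x - 1\<close> at \<open>x = s / t\<close>.\<close>

lemma mult_ln_tangent:
  assumes "0 \<le> t" "0 < (s::real)"
  shows "t * ln \<bar>t\<bar> \<ge> s * ln s + (ln s + 1) * (t - s)"
proof (cases "t = 0")
  case False
  then have t: "t > 0" using assms by simp
  have "ln (s / t) \<le> s / t - 1" using ln_le_minus_one[of "s / t"] t assms by simp
  then have "t * (ln s - ln t) \<le> s - t"
    using t assms by (simp add: ln_div field_simps)
  then show ?thesis using t by (simp add: algebra_simps)
qed (use assms in \<open>simp add: algebra_simps\<close>)

text \<open>The bound is the value at \<open>a = 0\<close>, the worst centre. For a centre inside
  the interval, the tangents at \<open>r\<close> taken at \<open>r - a\<close> and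
  \<open>r + a\<close> have opposite linear terms, which cancel.\<close>

lemma integral_ln_abs_ge:
  fixes a r :: real
  assumes "0 < r"
  shows "integral {-r..r} (\<lambda>x. ln \<bar>x - a\<bar>) \<ge> 2 * r * (ln r - 1)"
proof -
  have "integral {-r..r} (\<lambda>x. ln \<bar>x - a\<bar>)
     = (r - a) * ln \<bar>r - a\<bar> + (r + a) * ln \<bar>r + a\<bar> - 2 * r"
  proof -
    have "\<bar>-r-a\<bar> = \<bar>r+a\<bar>" by simp
    then show ?thesis
      using integral_unique[OF has_integral_ln_abs[of "-r" r a]] assms by (simp add: algebra_simps)
  qed
  moreover have "(r - a) * ln \<bar>r - a\<bar> + (r + a) * ln \<bar>r + a\<bar> \<ge> 2 * r * ln r"
  proof -
    \<comment> \<open>For a centre outside, one term changes sign; replacing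
      \<open>ln (a - r)\<close> and \<open>ln r\<close> by the larger \<open>ln (r + a)\<close>
      suffices, since \<open>(a - r) + 2 * r = r + a\<close>.\<close>
    have out: "(a - r) * ln (a - r) \<le> (r + a) * ln (r + a) - 2 * r * ln r" if "a > r" for a
    proof -
      have "(a - r) * ln (a - r) \<le> (a - r) * ln (r + a)"
        using that assms by (intro mult_left_mono) auto
      moreover have "2 * r * ln r \<le> 2 * r * ln (r + a)"
        using that assms by (intro mult_left_mono) auto
      ultimately show ?thesis by (simp add: algebra_simps)
    qed
    consider "\<bar>a\<bar> \<le> r" | "a > r" | "-a > r" using assms by linarith
    then show ?thesis
    proof cases
      case 1
      then show ?thesis
        using add_mono[OF mult_ln_tangent[of "r - a" r] mult_ln_tangent[of "r + a" r]] assms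
        by (auto simp: algebra_simps)
    next
      case 2
      then show ?thesis using out[of a] assms by (simp add: algebra_simps)
    next
      case 3
      then have "\<bar>r + a\<bar> = - a - r" "\<bar>r - a\<bar> = r + (-a)" using assms by auto
      then show ?thesis using out[of "-a"] 3 by (simp add: algebra_simps)
    qed
  qed
  ultimately show ?thesis by (simp add: algebra_simps)
qed

text \<open>Over the complex numbers the polynomial splits into linear factors. Moving each root to
  its real part only decreases the factor at real points, so each factor contributes at least the
  bound for a real centre.\<close>

lemma integral_ge_if_dominates_monic_poly:
  fixes p :: "real poly" and h :: "real \<Rightarrow> real"
  assumes p: "lead_coeff p = 1" and r: "0 < r"
    and h: "h integrable_on {-r..r}"
    and le: "\<And>x. x \<in> {-r..r} \<Longrightarrow> poly p x \<noteq> 0 \<Longrightarrow> ln \<bar>poly p x\<bar> \<le> h x"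
  shows "integral {-r..r} h \<ge> real (degree p) * (2 * r * (ln r - 1))"
proof -
  define P where "P = map_poly complex_of_real p"
  have "p \<noteq> 0" using p by auto
  have degP: "degree P = degree p" unfolding P_def by (rule degree_map_poly) auto
  have lcP: "lead_coeff P = 1" using p by (simp add: degP) (simp add: P_def coeff_map_poly)
  have "P \<noteq> 0" using lcP by auto
  from alg_closed_imp_factorization[OF this] lcP degP
  obtain A where A: "size A = degree p" "P = (\<Prod>z\<in>#A. [:-z, 1:])" by auto
  have abs_p: "\<bar>poly p x\<bar> = (\<Prod>z\<in>#A. cmod (complex_of_real x - z))" for x
  proof -
    have "complex_of_real (poly p x) = poly P (of_real x)"
      unfolding P_def by (induction p) (simp_all add: map_poly_pCons)
    also have "\<dots> = (\<Prod>z\<in>#A. complex_of_real x - z)"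
      by (simp add: A(2) poly_prod_mset)
    finally have "\<bar>poly p x\<bar> = cmod (\<Prod>z\<in>#A. complex_of_real x - z)"
      by (metis norm_of_real real_norm_def)
    also have "\<dots> = (\<Prod>z\<in>#A. cmod (complex_of_real x - z))"
      by (induction A) (auto simp: norm_mult)
    finally show ?thesis .
  qed
  let ?g = "\<lambda>B x. \<Sum>z\<in>#B. ln \<bar>x - Re z\<bar>"
  have g: "(?g B has_integral (\<Sum>z\<in>#B. integral {-r..r} (\<lambda>x. ln \<bar>x - Re z\<bar>))) {-r..r}" for B
  proof (induction B)
    case (add z B)
    have "((\<lambda>x. ln \<bar>x - Re z\<bar>) has_integral integral {-r..r} (\<lambda>x. ln \<bar>x - Re z\<bar>)) {-r..r}"
      using has_integral_ln_abs[of "-r" r "Re z"] r by (auto intro: integrable_integral)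
    from has_integral_add[OF this add] show ?case by simp
  qed simp
  have sz: "(\<Sum>z\<in>#B. integral {-r..r} (\<lambda>x. ln \<bar>x - Re z\<bar>)) \<ge> real (size B) * (2 * r * (ln r - 1))" for B
  proof (induction B)
    case (add z B)
    then show ?case using integral_ln_abs_ge[OF r, of "Re z"] by (simp add: algebra_simps)
  qed simp
  have glep: "?g B x \<le> ln (\<Prod>z\<in>#B. cmod (complex_of_real x - z))"
    if "x \<notin> Re ` set_mset B" for B x
    using that
  proof (induction B)
    case (add z B)
    have "(\<Prod>z\<in>#C. cmod (complex_of_real x - z)) > 0" if "x \<notin> Re ` set_mset C" for C
      using that by (induction C) (auto simp: complex_eq_iff)
    then have pos: "(\<Prod>z\<in>#B. cmod (complex_of_real x - z)) > 0" "\<bar>x - Re z\<bar> > 0"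
      using add.prems by auto
    have "\<bar>x - Re z\<bar> \<le> cmod (complex_of_real x - z)"
      using abs_Re_le_cmod[of "complex_of_real x - z"] by simp
    then have "cmod (complex_of_real x - z) > 0" "ln \<bar>x - Re z\<bar> \<le> ln (cmod (complex_of_real x - z))"
      using pos(2) by (linarith, subst ln_le_cancel_iff) auto
    moreover have "ln (a * b) = ln a + ln b" if "a > 0" "b > 0" for a b :: real
      using that by (simp add: ln_mult)
    ultimately have "ln (\<Prod>z\<in>#add_mset z B. cmod (complex_of_real x - z))
        = ln (cmod (complex_of_real x - z)) + ln (\<Prod>z\<in>#B. cmod (complex_of_real x - z))"
      using pos(1) by simp
    then show ?case
      using add \<open>ln \<bar>x - Re z\<bar> \<le> ln (cmod (complex_of_real x - z))\<close> by simp
  qed simp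
  \<comment> \<open>Where \<open>x\<close> meets the real part of a root, a summand is
    \<open>ln 0 = 0\<close> instead of minus infinity and the comparison with \<open>h\<close> may
    fail. Changing the value at these finitely many points leaves the integral unchanged.\<close>
  define g' where "g' x = (if x \<in> Re ` set_mset A then h x else ?g A x)" for x
  have "(g' has_integral (\<Sum>z\<in>#A. integral {-r..r} (\<lambda>x. ln \<bar>x - Re z\<bar>))) {-r..r}"
    by (rule has_integral_spike_finite[OF _ _ g[of A], of "Re ` set_mset A"]) (auto simp: g'_def)
  moreover have "g' x \<le> h x" if "x \<in> {-r..r}" for x
  proof (cases "x \<in> Re ` set_mset A")
    case False
    then have "poly p x \<noteq> 0"
      using abs_p[of x] by (force simp: complex_eq_iff prod_mset_zero_iff)
    then have "ln \<bar>poly p x\<bar> \<le> h x" using le that by simp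
    moreover have "?g A x \<le> ln \<bar>poly p x\<bar>" using glep[OF False] abs_p by simp
    ultimately show ?thesis using False by (simp add: g'_def)
  qed (simp add: g'_def)
  ultimately have "(\<Sum>z\<in>#A. integral {-r..r} (\<lambda>x. ln \<bar>x - Re z\<bar>)) \<le> integral {-r..r} h"
    using h by (meson has_integral_le integrable_integral)
  then show ?thesis using sz[of A] A(1) by simp
qed

section \<open>The Lyapunov exponent of a two-valued process\<close>

text \<open>Fekete's lemma: divide \<open>n\<close> by a good \<open>m\<close> with remainder; the
  remainder costs a constant, which disappears after division by \<open>n\<close>.\<close>

lemma subadditive_quotient_limit:
  fixes a :: "nat \<Rightarrow> real"
  assumes sub: "\<And>m n. a (m + n) \<le> a m + a n" and nonneg: "\<And>n. 0 \<le> a n"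
  shows "(\<lambda>n. a n / real n) \<longlonglongrightarrow> (INF n\<in>{1..}. a n / real n)"
proof -
  define L where "L = (INF n\<in>{1..}. a n / real n)"
  have bdd: "bdd_below ((\<lambda>n. a n / real n) ` {1..})"
    by (rule bdd_belowI[of _ 0]) (auto simp: nonneg)
  have L_le: "L \<le> a n / real n" if "n \<ge> 1" for n
    unfolding L_def using that by (intro cINF_lower bdd) auto
  have mult: "a (k * m + r) \<le> real k * a m + a r" for k m r
  proof (induction k)
    case (Suc k)
    have "a (Suc k * m + r) \<le> a m + a (k * m + r)"
      using sub[of m "k * m + r"] by (simp add: add.assoc)
    then show ?case using Suc by (simp add: algebra_simps)
  qed simp
  have a0: "a n \<le> real n * a 1 + a 0" for n using mult[of n 1 0] by simp
  show ?thesis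
    unfolding L_def[symmetric]
  proof (rule LIMSEQ_I)
    fix e :: real assume e: "0 < e"
    have "L < L + e / 2" using e by simp
    then obtain m where m: "m \<ge> 1" "a m / real m < L + e / 2"
      unfolding L_def by (subst (asm) cINF_less_iff[OF _ bdd]) auto
    \<comment> \<open>A common bound for \<open>a r\<close> over all remainders
      \<open>r < m\<close>.\<close>
    define B where "B = real m * a 1 + a 0"
    have B: "a r \<le> B" if "r < m" for r
    proof -
      have "real r * a 1 \<le> real m * a 1" using that nonneg by (intro mult_right_mono) auto
      then show ?thesis using a0[of r] by (simp add: B_def)
    qed
    obtain n0 :: nat where n0: "real n0 > B / (e / 2)" using reals_Archimedean2 by blast
    show "\<exists>no. \<forall>n\<ge>no. norm (a n / real n - L) < e"
    proof (intro exI[of _ "Suc n0"] allI impI)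
      fix n assume n: "Suc n0 \<le> n"
      then have npos: "real n > 0" by simp
      have "a n \<le> real (n div m) * a m + a (n mod m)" using mult[of "n div m" m "n mod m"] by simp
      also have "\<dots> \<le> real (n div m) * a m + B" using B m by simp
      also have "real (n div m) * a m = real (n div m * m) * (a m / real m)" using m by simp
      also have "\<dots> \<le> real n * (a m / real m)"
        by (intro mult_right_mono) (auto simp: nonneg simp del: of_nat_mult)
      finally have "a n / real n \<le> a m / real m + B / real n"
        using npos by (simp add: field_simps)
      moreover have "B / real n < e / 2"
      proof -
        have "B < real n0 * (e / 2)" using n0 e by (simp add: field_simps)
        also have "\<dots> \<le> real n * (e / 2)" using n e by (intro mult_right_mono) auto
        finally show ?thesis using npos by (simp add: field_simps)
      qed
      ultimately have "a n / real n < L + e" using m(2) by linarith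
      moreover have "L \<le> a n / real n" using n by (intro L_le) simp
      ultimately show "norm (a n / real n - L) < e" by simp
    qed
  qed
qed

definition seq_shift :: "(int \<Rightarrow> real) \<Rightarrow> int \<Rightarrow> real" where
  "seq_shift \<omega> = (\<lambda>i. \<omega> (i + 1))"

lemma seq_shift_funpow: "(seq_shift ^^ n) \<omega> = (\<lambda>i. \<omega> (i + int n))"
  by (induction n) (simp_all add: seq_shift_def fun_eq_iff algebra_simps)

definition log_growth :: "nat \<Rightarrow> real \<Rightarrow> (int \<Rightarrow> real) \<Rightarrow> real" where
  "log_growth N E \<omega> = ln (onorm ((*v) (transfer_matrix N E \<omega>)))"

text \<open>A word over two letters is coded by the positions of one of them, so that the words of
  length \<open>N\<close> form the finite set \<open>Pow {..<N}\<close>.\<close>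

definition window_word :: "nat \<Rightarrow> (int \<Rightarrow> real) \<Rightarrow> nat set" where
  "window_word N \<omega> = {n. n < N \<and> \<omega> (int n) = 2}"

text \<open>Decodes a word. At negative sites \<open>nat\<close> truncates to \<open>0\<close>; the
  value there is immaterial, since transfer matrices read only nonnegative sites.\<close>

definition word_sequence :: "nat set \<Rightarrow> int \<Rightarrow> real" where
  "word_sequence S i = (if nat i \<in> S then 2 else -2)"

locale two_valued_shift = prob_space M for M :: "(int \<Rightarrow> real) measure" +
  assumes measurable_eval [measurable]: "\<And>n. (\<lambda>\<omega>. \<omega> n) \<in> borel_measurable M"
    and measurable_shift [measurable]: "seq_shift \<in> measurable M M"
    and distr_shift: "distr M M seq_shift = M"
    and two_valued: "\<And>\<omega> n. \<omega> \<in> space M \<Longrightarrow> \<omega> n = 2 \<or> \<omega> n = -2"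
begin

definition mean_growth :: "nat \<Rightarrow> real \<Rightarrow> real" where
  "mean_growth N E = (\<integral>\<omega>. log_growth N E \<omega> \<partial>M)"

text \<open>Only \<open>N\<close> sites are read, so the logarithmic growth is a step function of
  the sequence; this settles measurability and integrability.\<close>

lemma log_growth_word:
  assumes "\<omega> \<in> space M"
  shows "log_growth N E \<omega> = (\<Sum>S\<in>Pow {..<N}. indicator {\<omega>\<in>space M. window_word N \<omega> = S} \<omega> * log_growth N E (word_sequence S))"
proof -
  have "log_growth N E \<omega> = log_growth N E (word_sequence (window_word N \<omega>))"
    unfolding log_growth_def
    using two_valued[OF assms] by (subst transfer_matrix_cong[of N \<omega> "word_sequence (window_word N \<omega>)"])
      (auto simp: word_sequence_def window_word_def)
  also have "\<dots> = (\<Sum>S\<in>{window_word N \<omega>}. indicator {\<omega>\<in>space M. window_word N \<omega> = S} \<omega> * log_growth N E (word_sequence S))"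
    using assms by simp
  also have "\<dots> = (\<Sum>S\<in>Pow {..<N}. indicator {\<omega>\<in>space M. window_word N \<omega> = S} \<omega> * log_growth N E (word_sequence S))"
  proof (rule sum.mono_neutral_left)
    show "{window_word N \<omega>} \<subseteq> Pow {..<N}" by (auto simp: window_word_def)
  qed (auto simp: indicator_def)
  finally show ?thesis .
qed

lemma sets_window_word [measurable]: "{\<omega>\<in>space M. window_word N \<omega> = S} \<in> sets M"
proof -
  have "{\<omega>\<in>space M. window_word N \<omega> = S} = {\<omega>\<in>space M. S \<subseteq> {..<N} \<and> (\<forall>n<N. (\<omega> (int n) = 2) = (n \<in> S))}"
    by (auto simp: window_word_def)
  also have "\<dots> \<in> sets M" by measurable
  finally show ?thesis .
qed

lemma integrable_log_growth: "integrable M (log_growth N E)"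
  by (rule Bochner_Integration.integrable_cong[OF refl log_growth_word, THEN iffD2], assumption)
    (intro Bochner_Integration.integrable_sum integrable_mult_left integrable_real_indicator
      sets_window_word, simp add: less_top[symmetric])

text \<open>Only finitely many words of length \<open>N\<close> occur, so continuity in \<open>E\<close> and the exchange of the
  integrals over \<open>E\<close> and \<open>\<omega>\<close> are statements about finite sums.\<close>
lemma mean_growth_sum:
  "mean_growth N E = (\<Sum>S\<in>Pow {..<N}. prob {\<omega>\<in>space M. window_word N \<omega> = S} * log_growth N E (word_sequence S))"
proof -
  have "mean_growth N E = (\<integral>\<omega>. (\<Sum>S\<in>Pow {..<N}. indicator {\<omega>\<in>space M. window_word N \<omega> = S} \<omega> * log_growth N E (word_sequence S)) \<partial>M)"
    unfolding mean_growth_def by (intro Bochner_Integration.integral_cong refl log_growth_word)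
  also have "\<dots> = (\<Sum>S\<in>Pow {..<N}. prob {\<omega>\<in>space M. window_word N \<omega> = S} * log_growth N E (word_sequence S))"
    by (subst Bochner_Integration.integral_sum)
      (auto intro!: integrable_mult_left integrable_real_indicator simp: less_top[symmetric])
  finally show ?thesis .
qed

lemma sum_prob_window_word: "(\<Sum>S\<in>Pow {..<N}. prob {\<omega>\<in>space M. window_word N \<omega> = S}) = 1"
proof -
  have "(\<Sum>S\<in>Pow {..<N}. prob {\<omega>\<in>space M. window_word N \<omega> = S})
      = prob (\<Union>S\<in>Pow {..<N}. {\<omega>\<in>space M. window_word N \<omega> = S})"
    by (rule finite_measure_finite_Union[symmetric]) (auto simp: disjoint_family_on_def)
  also have "(\<Union>S\<in>Pow {..<N}. {\<omega>\<in>space M. window_word N \<omega> = S}) = space M"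
    by (auto simp: window_word_def)
  finally show ?thesis by (simp add: prob_space)
qed

lemma log_growth_nonneg: "0 \<le> log_growth N E \<omega>"
  unfolding log_growth_def using onorm_transfer_matrix_ge_1 by (simp add: ln_ge_zero)

lemma mean_growth_nonneg: "0 \<le> mean_growth N E"
  unfolding mean_growth_def by (intro Bochner_Integration.integral_nonneg log_growth_nonneg)

lemma log_growth_le:
  assumes "\<omega> \<in> space M" "\<bar>E\<bar> + 4 \<le> C"
  shows "log_growth N E \<omega> \<le> real N * ln C"
proof -
  have "onorm ((*v) (transfer_matrix N E \<omega>)) \<le> C ^ N"
  proof (rule onorm_transfer_matrix_le)
    \<comment> \<open>The \<open>4\<close> in the hypothesis is \<open>2\<close> for the size of the
      letters plus \<open>2\<close> for the entries \<open>-1\<close> and \<open>1\<close> of a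
      one-step matrix.\<close>
    show "\<bar>E - \<omega> (int n)\<bar> + 2 \<le> C" for n
      using two_valued[OF assms(1), of "int n"] assms(2) by auto
  qed
  then have "log_growth N E \<omega> \<le> ln (C ^ N)"
    unfolding log_growth_def using onorm_transfer_matrix_ge_1[of N E \<omega>] by (intro ln_mono) linarith+
  then show ?thesis using assms(2) by (simp add: ln_realpow)
qed

lemma mean_growth_le:
  assumes "\<bar>E\<bar> + 4 \<le> C"
  shows "mean_growth N E \<le> real N * ln C"
proof -
  have "mean_growth N E \<le> (\<integral>\<omega>. real N * ln C \<partial>M)"
    unfolding mean_growth_def using log_growth_le[OF _ assms]
    by (intro integral_mono integrable_log_growth) auto
  then show ?thesis by (simp add: prob_space)
qed

lemma continuous_on_mean_growth: "continuous_on X (mean_growth N)"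
proof -
  have "onorm ((*v) (transfer_matrix N E (word_sequence S))) \<noteq> 0" for E S
    using onorm_transfer_matrix_ge_1[of N E "word_sequence S"] by linarith
  then show ?thesis
    unfolding mean_growth_sum[abs_def] log_growth_def
    by (intro continuous_on_sum continuous_on_mult continuous_on_const continuous_on_ln
        continuous_on_onorm_transfer_matrix ballI)
qed

text \<open>The product over \<open>m + n\<close> sites splits into a product over \<open>n\<close>
  sites and one over \<open>m\<close> shifted sites; the norm is submultiplicative and the shift
  preserves the measure.\<close>

lemma mean_growth_subadditive: "mean_growth (m + n) E \<le> mean_growth m E + mean_growth n E"
proof -
  have meas: "(seq_shift ^^ n) \<in> measurable M M" for n
  proof (induction n)
    case (Suc n)
    then show ?case using measurable_comp[OF Suc measurable_shift] by simp
  qed (simp add: measurable_ident)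
  have distr: "distr M M (seq_shift ^^ n) = M" for n
  proof (induction n)
    case (Suc n)
    have "distr M M (seq_shift ^^ Suc n) = distr (distr M M (seq_shift ^^ n)) M seq_shift"
      by (subst distr_distr) (auto simp: meas)
    then show ?case using Suc distr_shift by (simp add: comp_def)
  qed (simp add: distr_id2)
  have meas_g: "log_growth m E \<in> borel_measurable M" using integrable_log_growth by auto
  have int: "integrable M (\<lambda>\<omega>. log_growth m E ((seq_shift ^^ n) \<omega>))"
    using integrable_distr[OF meas[of n], of "log_growth m E"] distr[of n] integrable_log_growth by simp
  have "mean_growth (m + n) E \<le> (\<integral>\<omega>. log_growth m E ((seq_shift ^^ n) \<omega>) + log_growth n E \<omega> \<partial>M)"
    unfolding mean_growth_def
  proof (intro integral_mono integrable_log_growth Bochner_Integration.integrable_add int)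
    fix \<omega>
    let ?A = "transfer_matrix m E ((seq_shift ^^ n) \<omega>)" and ?B = "transfer_matrix n E \<omega>"
    have "log_growth (m + n) E \<omega> = ln (onorm ((*v) (?A ** ?B)))"
      by (simp add: log_growth_def transfer_matrix_add seq_shift_funpow)
    also have "\<dots> \<le> ln (onorm ((*v) ?A) * onorm ((*v) ?B))"
    proof (rule ln_mono)
      show "0 < onorm ((*v) (?A ** ?B))"
        using onorm_ge_1_if_det_1[of "?A ** ?B"] by (simp add: det_mul)
    qed (rule onorm_matrix_mult_le)
    also have "\<dots> = log_growth m E ((seq_shift ^^ n) \<omega>) + log_growth n E \<omega>"
      unfolding log_growth_def using onorm_transfer_matrix_ge_1[of m E "(seq_shift ^^ n) \<omega>"] onorm_transfer_matrix_ge_1[of n E \<omega>]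
      by (intro ln_mult_pos) linarith+
    finally show "log_growth (m + n) E \<omega> \<le> log_growth m E ((seq_shift ^^ n) \<omega>) + log_growth n E \<omega>" .
  qed
  also have "\<dots> = (\<integral>\<omega>. log_growth m E ((seq_shift ^^ n) \<omega>) \<partial>M) + mean_growth n E"
    unfolding mean_growth_def by (intro Bochner_Integration.integral_add int integrable_log_growth)
  also have "(\<integral>\<omega>. log_growth m E ((seq_shift ^^ n) \<omega>) \<partial>M) = mean_growth m E"
    using integral_distr[OF meas[of n] meas_g] distr[of n] by (simp add: mean_growth_def)
  finally show ?thesis .
qed

abbreviation exponent :: "real \<Rightarrow> real" where
  "exponent \<equiv> lyapunov M seq_shift (\<lambda>\<omega>. \<omega> 0)"

lemma growth_tendsto_INF: "(\<lambda>N. mean_growth N E / real N) \<longlonglongrightarrow> (INF N\<in>{1..}. mean_growth N E / real N)"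
  by (rule subadditive_quotient_limit) (rule mean_growth_subadditive mean_growth_nonneg)+

lemma exponent_eq: "exponent E = (INF N\<in>{1..}. mean_growth N E / real N)"
proof -
  have "transfer_matrix N E (potential M seq_shift (\<lambda>\<omega>. \<omega> 0) \<omega>) = transfer_matrix N E \<omega>" for N \<omega>
    by (rule transfer_matrix_cong) (simp add: potential_def int_iterate_def seq_shift_funpow)
  then have "exponent E = lim (\<lambda>N. mean_growth N E / real N)"
    by (simp add: lyapunov_def mean_growth_def log_growth_def)
  also have "\<dots> = (INF N\<in>{1..}. mean_growth N E / real N)"
    using growth_tendsto_INF by (rule limI)
  finally show ?thesis .
qed

lemma growth_tendsto: "(\<lambda>N. mean_growth N E / real N) \<longlonglongrightarrow> exponent E"
  using growth_tendsto_INF by (simp add: exponent_eq)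

lemma exponent_le:
  assumes "N \<ge> 1"
  shows "exponent E \<le> mean_growth N E / real N"
  unfolding exponent_eq using assms
  by (intro cINF_lower bdd_belowI[of _ 0]) (auto simp: mean_growth_nonneg)

lemma exponent_nonneg: "0 \<le> exponent E"
  unfolding exponent_eq by (intro cINF_greatest) (auto simp: mean_growth_nonneg)

lemma open_exponent_less: "open {E. exponent E < c}"
proof -
  have "{E. exponent E < c} = (\<Union>N\<in>{1..}. {E. mean_growth N E / real N < c})"
  proof (intro set_eqI iffI)
    fix E assume "E \<in> {E. exponent E < c}"
    then have "exponent E < c" by simp
    then have "\<exists>N\<in>{1..}. mean_growth N E / real N < c"
      unfolding exponent_eq
      by (subst (asm) cINF_less_iff) (auto intro!: bdd_belowI[of _ 0] simp: mean_growth_nonneg)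
    then show "E \<in> (\<Union>N\<in>{1..}. {E. mean_growth N E / real N < c})" by auto
  next
    fix E assume "E \<in> (\<Union>N\<in>{1..}. {E. mean_growth N E / real N < c})"
    then obtain N :: nat where "1 \<le> N" "mean_growth N E / real N < c" by auto
    then show "E \<in> {E. exponent E < c}" using exponent_le[of N E] by auto
  qed
  also have "open \<dots>"
    by (intro open_UN ballI open_Collect_less continuous_intros continuous_on_mean_growth) auto
  finally show ?thesis .
qed

text \<open>For each single word the norm dominates the upper left entry, a monic polynomial of
  degree \<open>N\<close>. The bound does not depend on the word, and the probabilities of the words
  add up to 1.\<close>

lemma integral_mean_growth_ge:
  assumes "0 < r"
  shows "real N * (2 * r * (ln r - 1)) \<le> integral {-r..r} (mean_growth N)"
proof -
  have word: "real N * (2 * r * (ln r - 1)) \<le> integral {-r..r} (\<lambda>E. log_growth N E V)"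
    and int: "(\<lambda>E. log_growth N E V) integrable_on {-r..r}" for V
  proof -
    obtain p where p: "degree p = N" "lead_coeff p = 1"
      "\<And>E. transfer_matrix N E V $ 1 $ 1 = poly p E"
      using transfer_matrix_poly[of N V] by blast
    show int: "(\<lambda>E. log_growth N E V) integrable_on {-r..r}"
      unfolding log_growth_def
    proof (intro integrable_continuous_real continuous_on_ln continuous_on_onorm_transfer_matrix ballI)
      show "onorm ((*v) (transfer_matrix N E V)) \<noteq> 0" for E
        using onorm_transfer_matrix_ge_1[of N E V] by linarith
    qed
    have "ln \<bar>poly p E\<bar> \<le> log_growth N E V" if "poly p E \<noteq> 0" for E
      unfolding log_growth_def p(3)[symmetric]
      using that p(3) by (intro ln_mono onorm_ge_entry) auto
    then show "real N * (2 * r * (ln r - 1)) \<le> integral {-r..r} (\<lambda>E. log_growth N E V)"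
      using integral_ge_if_dominates_monic_poly[OF p(2) assms int] p(1) by simp
  qed
  have "real N * (2 * r * (ln r - 1))
     = (\<Sum>S\<in>Pow {..<N}. prob {\<omega>\<in>space M. window_word N \<omega> = S} * (real N * (2 * r * (ln r - 1))))"
    unfolding sum_distrib_right[symmetric] sum_prob_window_word by simp
  also have "\<dots> \<le> (\<Sum>S\<in>Pow {..<N}. prob {\<omega>\<in>space M. window_word N \<omega> = S} *
       integral {-r..r} (\<lambda>E. log_growth N E (word_sequence S)))"
    by (intro sum_mono mult_left_mono word) auto
  also have "\<dots> = integral {-r..r} (mean_growth N)"
    unfolding mean_growth_sum[abs_def]
    by (subst integral_sum) (auto intro!: integrable_on_mult_right int)
  finally show ?thesis .
qed

lemma integral_exponent_ge:
  assumes "0 < r"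
  shows "exponent integrable_on {-r..r}" "2 * r * (ln r - 1) \<le> integral {-r..r} exponent"
proof -
  \<comment> \<open>The index starts at 1 to avoid the quotient by zero; the trivial norm bound
    supplies the constant majorant \<open>ln (r + 4)\<close>.\<close>
  let ?g = "\<lambda>N E. mean_growth (Suc N) E / real (Suc N)"
  have int: "?g N integrable_on {-r..r}" for N
    by (intro integrable_continuous_real continuous_intros continuous_on_mean_growth) auto
  have bound: "norm (?g N E) \<le> ln (r + 4)" if "E \<in> {-r..r}" for N E
  proof -
    have "\<bar>E\<bar> + 4 \<le> r + 4" using that by auto
    from mean_growth_le[OF this, of "Suc N"] show ?thesis
      using mean_growth_nonneg[of "Suc N" E]
      by (simp add: pos_divide_le_eq mult.commute[of "ln _"] del: of_nat_Suc)
  qed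
  have lim: "(\<lambda>N. ?g N E) \<longlonglongrightarrow> exponent E" for E
    using LIMSEQ_Suc[OF growth_tendsto] .
  note dc = dominated_convergence[of ?g "{-r..r}" "\<lambda>_. ln (r + 4)" exponent, OF int _ bound lim]
  show "exponent integrable_on {-r..r}" by (rule dc) auto
  have conv: "(\<lambda>N. integral {-r..r} (?g N)) \<longlonglongrightarrow> integral {-r..r} exponent" by (rule dc) auto
  show "2 * r * (ln r - 1) \<le> integral {-r..r} exponent"
  proof (rule LIMSEQ_le_const[OF conv], intro exI allI impI)
    fix N :: nat
    have "real (Suc N) * (2 * r * (ln r - 1)) \<le> integral {-r..r} (mean_growth (Suc N))"
      by (rule integral_mean_growth_ge[OF assms])
    moreover have "integral {-r..r} (?g N) = integral {-r..r} (mean_growth (Suc N)) / real (Suc N)"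
      using integral_mult_right[of "{-r..r}" "1 / real (Suc N)" "mean_growth (Suc N)"] by simp
    ultimately show "2 * r * (ln r - 1) \<le> integral {-r..r} (?g N)"
      by (simp add: field_simps del: of_nat_Suc)
  qed
qed

text \<open>The exponent is an infimum over scales, so one scale is enough. On the exceptional set
  the trivial bound \<open>N * ln C\<close> is paid, and the factor \<open>N\<close>
  cancels.\<close>

lemma exponent_le_if_mostly_slow:
  assumes N: "N \<ge> 1" and E: "\<bar>E\<bar> + 4 \<le> C" and c: "0 \<le> c"
    and B: "B \<in> events"
    and slow: "\<And>\<omega>. \<omega> \<in> space M - B \<Longrightarrow> log_growth N E \<omega> \<le> real N * c"
  shows "exponent E \<le> c + ln C * prob B"
proof -
  have "mean_growth N E \<le> (\<integral>\<omega>. real N * c + real N * ln C * indicator B \<omega> \<partial>M)"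
    unfolding mean_growth_def
  proof (intro integral_mono integrable_log_growth)
    show "integrable M (\<lambda>\<omega>. real N * c + real N * ln C * indicator B \<omega>)"
      using B by (auto intro!: integrable_real_indicator simp: less_top[symmetric])
    show "log_growth N E \<omega> \<le> real N * c + real N * ln C * indicator B \<omega>" if "\<omega> \<in> space M" for \<omega>
      using log_growth_le[OF that E, of N] slow[of \<omega>] that c
      by (cases "\<omega> \<in> B") (auto intro: order_trans)
  qed
  also have "\<dots> = real N * (c + ln C * prob B)"
    using B by (subst Bochner_Integration.integral_add)
      (auto intro!: integrable_real_indicator simp: less_top[symmetric] prob_space algebra_simps)
  finally have "mean_growth N E / real N \<le> c + ln C * prob B"
    using N by (simp add: field_simps)
  then show ?thesis using exponent_le[OF N, of E] by simp
qed

text \<open>Baire's theorem on \<open>[-4, 4]\<close>: the sublevel sets are open by semicontinuity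
  and dense by hypothesis, and their intersection is the zero set.\<close>

lemma generic_zero_exponent:
  assumes small: "\<And>E0 e d. E0 \<in> {-4<..<4} \<Longrightarrow> 0 < e \<Longrightarrow> 0 < d \<Longrightarrow> \<exists>E. \<bar>E - E0\<bar> < d \<and> exponent E < e"
  shows "generically_on {-4..4} (\<lambda>E. exponent E = 0)"
proof -
  define G where "G k = {-4..4} \<inter> {E. exponent E < 1 / real (Suc k)}" for k :: nat
  have open_G: "openin (top_of_set {-4..4}) (G k)" for k
    unfolding G_def by (intro openin_open_Int open_exponent_less)
  have dense_G: "{-4..4} \<subseteq> closure (G k)" for k
  proof -
    have "{-4<..<4} \<subseteq> closure (G k)"
    proof
      fix E0 :: real assume E0: "E0 \<in> {-4<..<4}"
      show "E0 \<in> closure (G k)"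
        unfolding closure_approachable
      proof (intro allI impI)
        fix d :: real assume "0 < d"
        \<comment> \<open>The radius is cut down so that the approximating energy stays in the
          interval.\<close>
        then have "0 < min d (min (E0 + 4) (4 - E0))" using E0 by auto
        then obtain E where "\<bar>E - E0\<bar> < min d (min (E0 + 4) (4 - E0))" "exponent E < 1 / real (Suc k)"
          using small[OF E0, of "1 / real (Suc k)"] by fastforce
        then show "\<exists>y\<in>G k. dist y E0 < d"
          by (intro bexI[of _ E]) (auto simp: G_def dist_real_def abs_if split: if_splits)
      qed
    qed
    then have "closure {-4<..<4} \<subseteq> closure (G k)" by (intro closure_minimal) auto
    then show ?thesis by simp
  qed
  have "{-4..4} \<subseteq> closure (\<Inter>(range G))"
    using open_G dense_G by (intro Baire) auto
  moreover have "\<Inter>(range G) \<subseteq> {-4..4}" by (auto simp: G_def)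
  ultimately have "top_of_set {-4..4} closure_of \<Inter>(range G) = {-4..4}"
    by (auto simp: closure_of_subtopology Int_absorb1)
  moreover have "gdelta_in (top_of_set {-4..4}) (\<Inter>(range G))"
    using open_G by (intro gdelta_in_Inter) (auto intro: open_imp_gdelta_in)
  moreover have "exponent E = 0" if "E \<in> \<Inter>(range G)" for E
  proof (rule ccontr)
    assume "exponent E \<noteq> 0"
    then have "0 < exponent E" using exponent_nonneg[of E] by simp
    then obtain k where "1 / real (Suc k) < exponent E" using nat_approx_posE by blast
    moreover have "E \<in> G k" using that by blast
    ultimately show False by (simp add: G_def)
  qed
  ultimately show ?thesis unfolding generically_on_def by blast
qed

text \<open>At a continuity point inside the interval the densely small values force the exponent to
  vanish. If the discontinuities were null, the integral would be zero, against the bound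
  \<open>8 * (ln 4 - 1) > 0\<close>.\<close>

lemma exponent_discontinuity:
  assumes small: "\<And>E0 e d. E0 \<in> {-4<..<4} \<Longrightarrow> 0 < e \<Longrightarrow> 0 < d \<Longrightarrow> \<exists>E. \<bar>E - E0\<bar> < d \<and> exponent E < e"
  shows "0 < emeasure lebesgue {E. \<not> isCont exponent E}"
proof (rule ccontr)
  let ?D = "{E. \<not> isCont exponent E}"
  assume "\<not> 0 < emeasure lebesgue ?D"
  then have "emeasure lebesgue ?D = 0" by simp
  \<comment> \<open>Indispensable here: \<open>emeasure\<close> is also \<open>0\<close> on
    nonmeasurable sets, so the value alone would not make the set negligible. The continuity points
    of any function form a Borel set.\<close>
  moreover have "?D \<in> sets borel" by measurable
  ultimately have "negligible ?D"
    by (simp add: negligible_iff_emeasure0)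
  then have neg: "negligible (?D \<union> {-4, 4})" by (intro negligible_Un) auto
  have "exponent E = 0" if "E \<in> {-4..4} - (?D \<union> {-4, 4})" for E
  proof (rule ccontr)
    assume "exponent E \<noteq> 0"
    then have pos: "0 < exponent E" using exponent_nonneg[of E] by simp
    have E: "isCont exponent E" "E \<in> {-4<..<4}" using that by auto
    from E(1) pos obtain d where d: "0 < d" "\<And>E'. \<bar>E' - E\<bar> < d \<Longrightarrow> \<bar>exponent E' - exponent E\<bar> < exponent E / 2"
      unfolding continuous_at_eps_delta dist_real_def by (meson half_gt_zero)
    obtain E' where "\<bar>E' - E\<bar> < d" "exponent E' < exponent E / 2"
      using small[OF E(2) _ d(1), of "exponent E / 2"] pos by auto
    with d(2)[of E'] show False by linarith
  qed
  then have "integral {-4..4} exponent = integral {-4..4::real} (\<lambda>_. 0)"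
    by (intro integral_spike[OF neg]) auto
  moreover have "1 < ln (4 :: real)"
  proof -
    have "exp 1 < (4 :: real)" using exp_le by linarith
    then show ?thesis by (metis exp_gt_zero ln_exp ln_less_cancel_iff zero_less_numeral)
  qed
  ultimately show False using integral_exponent_ge(2)[of 4] by simp
qed

end

section \<open>Periodic potentials\<close>

text \<open>The operator \<open>H - E\<close> on real sequences, without any summability; it is
  applied to periodic ones.\<close>

definition hopping :: "(int \<Rightarrow> real) \<Rightarrow> real \<Rightarrow> (int \<Rightarrow> real) \<Rightarrow> int \<Rightarrow> real" where
  "hopping w E u i = u (i + 1) + u (i - 1) + (w i - E) * u i"

definition periodic_with :: "int \<Rightarrow> (int \<Rightarrow> 'a) \<Rightarrow> bool" where
  "periodic_with q u \<longleftrightarrow> (\<forall>i. u (i + q) = u i)"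

lemma periodic_with_mult:
  assumes "periodic_with q u"
  shows "u (i + k * q) = u i"
proof -
  have nat: "u (i + int n * q) = u i" for n i
  proof (induction n)
    case (Suc n)
    have "u (i + int (Suc n) * q) = u (i + int n * q + q)" by (simp add: algebra_simps)
    then show ?case using assms Suc by (simp add: periodic_with_def)
  qed simp
  show ?thesis
  proof (cases "k \<ge> 0")
    case True then show ?thesis using nat[of i "nat k"] by simp
  next
    case False then show ?thesis using nat[of "i + k * q" "nat (- k)"] by (simp add: algebra_simps)
  qed
qed

lemma periodic_with_mod:
  assumes "periodic_with q u"
  shows "u (i mod q) = u i"
  using periodic_with_mult[OF assms, of "i mod q" "i div q"] by simp

lemma periodic_with_dvd:
  assumes "periodic_with q u" "q dvd q'"
  shows "periodic_with q' u"
  unfolding periodic_with_def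
proof
  fix i
  obtain k where "q' = q * k" using assms(2) ..
  then show "u (i + q') = u i"
    using periodic_with_mult[OF assms(1), of i k] by (simp add: mult.commute)
qed

lemma sum_periodic_shift:
  fixes g :: "int \<Rightarrow> real"
  assumes "periodic_with q g" "0 < q"
  shows "(\<Sum>i\<in>{0..<q}. g (i + 1)) = (\<Sum>i\<in>{0..<q}. g i)"
proof -
  have "(\<Sum>i\<in>{0..<q}. g (i + 1)) = (\<Sum>i\<in>{1..<q+1}. g i)"
    by (rule sum.reindex_bij_witness[of _ "\<lambda>i. i - 1" "\<lambda>i. i + 1"]) auto
  also have "{1..<q+1} = insert q {1..<q}" using assms by auto
  also have "(\<Sum>i\<in>insert q {1..<q}. g i) = g 0 + (\<Sum>i\<in>{1..<q}. g i)"
    using assms by (simp add: periodic_with_def) (metis add_0)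
  also have "\<dots> = (\<Sum>i\<in>insert 0 {1..<q}. g i)" by simp
  also have "insert 0 {1..<q} = {0..<q}" using assms by auto
  finally show ?thesis .
qed

lemma periodic_hopping:
  assumes "periodic_with q w" "periodic_with q u"
  shows "periodic_with q (hopping w E u)"
proof -
  have "u (i + q + 1) = u (i + 1)" "u (i + q - 1) = u (i - 1)" for i
    using assms(2) unfolding periodic_with_def by (metis add.commute add.left_commute, metis add_diff_eq diff_add_eq)
  then show ?thesis using assms by (simp add: periodic_with_def hopping_def)
qed

lemma hopping_symmetric:
  assumes "periodic_with q w" "periodic_with q u" "periodic_with q v" "0 < q"
  shows "(\<Sum>i\<in>{0..<q}. hopping w E u i * v i) = (\<Sum>i\<in>{0..<q}. u i * hopping w E v i)"
proof -
  have by_parts: "(\<Sum>i\<in>{0..<q}. a (i + 1) * b i) = (\<Sum>i\<in>{0..<q}. a i * b (i - 1))"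
    if "periodic_with q a" "periodic_with q b" for a b :: "int \<Rightarrow> real"
  proof -
    have "b (i + q - 1) = b (i - 1)" for i
      using that(2) unfolding periodic_with_def by (metis add_diff_eq diff_add_eq)
    then have "periodic_with q (\<lambda>i. a i * b (i - 1))"
      using that by (simp add: periodic_with_def)
    from sum_periodic_shift[OF this assms(4)] show ?thesis by simp
  qed
  have "(\<Sum>i\<in>{0..<q}. hopping w E u i * v i) = (\<Sum>i\<in>{0..<q}. u (i + 1) * v i)
      + (\<Sum>i\<in>{0..<q}. v i * u (i - 1)) + (\<Sum>i\<in>{0..<q}. (w i - E) * u i * v i)"
    unfolding sum.distrib[symmetric] by (rule sum.cong) (simp_all add: hopping_def algebra_simps)
  also have "\<dots> = (\<Sum>i\<in>{0..<q}. u i * v (i - 1)) + (\<Sum>i\<in>{0..<q}. v (i + 1) * u i)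
      + (\<Sum>i\<in>{0..<q}. (w i - E) * u i * v i)"
    unfolding by_parts[OF assms(2,3)] by_parts[OF assms(3,2)] ..
  also have "\<dots> = (\<Sum>i\<in>{0..<q}. u i * hopping w E v i)"
    unfolding sum.distrib[symmetric] by (rule sum.cong) (simp_all add: hopping_def algebra_simps)
  finally show ?thesis .
qed

lemma hopping_linear: "hopping w E (\<lambda>i. u i + t * v i) i = hopping w E u i + t * hopping w E v i"
  by (simp add: hopping_def algebra_simps)

text \<open>Tychonoff's theorem. Periodic sequences are kept inside this product, so the period can
  be a variable rather than the dimension of a type.\<close>

lemma compact_product_interval: "compact {u :: int \<Rightarrow> real. \<forall>i. u i \<in> {-1..1}}"
proof -
  have "compactin (product_topology (\<lambda>_::int. euclidean) UNIV) (PiE UNIV (\<lambda>_. {-1..1::real}))"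
    by (simp add: compactin_PiE)
  moreover have "PiE UNIV (\<lambda>_::int. {-1..1::real}) = {u. \<forall>i. u i \<in> {-1..1}}"
    by auto
  ultimately show ?thesis
    by (simp add: euclidean_product_topology)
qed

text \<open>A minimizer of the norm of \<open>(H - E) u\<close> on the unit sphere of the periodic sequences is an
  eigenvector of \<open>(H - E)\<^sup>2\<close>.\<close>
lemma hopping_minimizer:
  assumes w: "periodic_with q w" and q: "0 < q"
  shows "\<exists>u s. periodic_with q u \<and> u \<noteq> (\<lambda>_. 0) \<and> 0 \<le> s \<and>
     (\<forall>i. hopping w E (hopping w E u) i = s\<^sup>2 * u i) \<and>
     (\<forall>v. periodic_with q v \<longrightarrow>
        s\<^sup>2 * (\<Sum>i\<in>{0..<q}. (v i)\<^sup>2) \<le> (\<Sum>i\<in>{0..<q}. (hopping w E v i)\<^sup>2))"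
proof -
  let ?G = "hopping w E"
  define J where "J u = (\<Sum>i\<in>{0..<q}. (?G u i)\<^sup>2)" for u
  define n where "n u = (\<Sum>i\<in>{0..<q}. (u i)\<^sup>2)" for u :: "int \<Rightarrow> real"
  define K where "K = {u :: int \<Rightarrow> real. \<forall>i. u i \<in> {-1..1}} \<inter> ({u. periodic_with q u} \<inter> {u. n u = 1})"
  note [continuous_intros] = continuous_on_product_coordinates
  have "closed {u :: int \<Rightarrow> real. periodic_with q u}"
    unfolding periodic_with_def
    by (intro closed_Collect_all closed_Collect_eq continuous_intros)
  moreover have "closed {u. n u = 1}"
    unfolding n_def by (intro closed_Collect_eq continuous_intros)
  ultimately have "compact K"
    unfolding K_def by (intro compact_Int_closed compact_product_interval closed_Int)
  moreover have "continuous_on K J"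
    unfolding J_def hopping_def by (intro continuous_intros continuous_on_subset[OF continuous_on_product_coordinates]) auto
  moreover have inK: "(\<lambda>i. v i / sqrt (n v)) \<in> K" if v: "periodic_with q v" and nv: "n v > 0" for v
  proof -
    have "(v i)\<^sup>2 \<le> n v" for i
    proof -
      have "(v (i mod q))\<^sup>2 \<le> n v"
        unfolding n_def using q by (intro member_le_sum) auto
      then show ?thesis using periodic_with_mod[OF v] by simp
    qed
    then have "\<bar>v i\<bar> \<le> sqrt (n v)" for i by (rule real_le_rsqrt[of "\<bar>v i\<bar>", simplified])
    then have "v i / sqrt (n v) \<in> {-1..1}" for i
      using nv by (auto simp: abs_le_iff minus_le_iff divide_simps)
    moreover have "n (\<lambda>i. v i / sqrt (n v)) = n v / n v"
      using nv by (simp add: n_def power_divide flip: sum_divide_distrib)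
    ultimately show ?thesis using v nv by (simp add: K_def periodic_with_def)
  qed
  moreover have "n (\<lambda>_. 1) > 0" using q by (simp add: n_def)
  then have "K \<noteq> {}" using inK[of "\<lambda>_. 1"] by (auto simp: periodic_with_def)
  ultimately obtain u where u: "u \<in> K" "\<And>v. v \<in> K \<Longrightarrow> J u \<le> J v"
    using continuous_attains_inf[of K J] by blast
  have pu: "periodic_with q u" and nu: "n u = 1" using u by (auto simp: K_def)
  define s where "s = sqrt (J u)"
  have J0: "J v \<ge> 0" for v by (simp add: J_def sum_nonneg)
  have s2: "s\<^sup>2 = J u" using J0 by (simp add: s_def)
  have min: "s\<^sup>2 * n v \<le> J v" if v: "periodic_with q v" for v
  proof (cases "n v > 0")
    case True
    have "J (\<lambda>i. v i / sqrt (n v)) = J v / n v"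
    proof -
      have "?G (\<lambda>i. v i / sqrt (n v)) i = ?G v i / sqrt (n v)" for i
        using hopping_linear[of w E "\<lambda>_. 0" "1 / sqrt (n v)" v i] by (simp add: hopping_def)
      then show ?thesis using True
        by (simp add: J_def power_divide flip: sum_divide_distrib)
    qed
    then have "J u \<le> J v / n v" using u(2)[OF inK[OF v True]] by simp
    then show ?thesis using True s2 by (simp add: field_simps)
  next
    case False
    moreover have "n v \<ge> 0" by (simp add: n_def sum_nonneg)
    ultimately show ?thesis using J0 by simp
  qed
  have crit: "?G (?G u) i = s\<^sup>2 * u i" for i
  proof -
    \<comment> \<open>Half the gradient at \<open>u\<close> of the nonnegative functional
      \<open>J - s\<^sup>2 * n\<close>, which vanishes at \<open>u\<close>. Along this direction its
      linear term is \<open>2 * n v\<close>, so \<open>n v\<close> has to be zero.\<close>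
    define v where "v i = ?G (?G u) i - s\<^sup>2 * u i" for i
    have pG: "periodic_with q (?G u)" "periodic_with q (?G (?G u))"
      by (auto intro!: periodic_hopping w pu)
    have pv: "periodic_with q v" using pG pu by (simp add: v_def periodic_with_def)
    have exp: "J (\<lambda>i. u i + t * v i) - s\<^sup>2 * n (\<lambda>i. u i + t * v i)
        = t * (2 * n v + t * (J v - s\<^sup>2 * n v))" for t
    proof -
      have "J (\<lambda>i. u i + t * v i) = J u + 2 * t * (\<Sum>i\<in>{0..<q}. ?G u i * ?G v i) + t\<^sup>2 * J v"
        unfolding J_def hopping_linear
        by (simp add: power2_eq_square algebra_simps sum.distrib sum_distrib_left)
      moreover have "n (\<lambda>i. u i + t * v i) = n u + 2 * t * (\<Sum>i\<in>{0..<q}. u i * v i) + t\<^sup>2 * n v"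
        unfolding n_def
        by (simp add: power2_eq_square algebra_simps sum.distrib sum_distrib_left)
      moreover have "(\<Sum>i\<in>{0..<q}. ?G u i * ?G v i) - s\<^sup>2 * (\<Sum>i\<in>{0..<q}. u i * v i) = n v"
        unfolding hopping_symmetric[OF w pG(1) pv q, symmetric]
        by (simp add: n_def v_def power2_eq_square algebra_simps sum_subtractf sum_distrib_left flip: sum.distrib)
      ultimately show ?thesis using nu s2
        by (simp add: power2_eq_square algebra_simps)
    qed
    have pos: "0 \<le> t * (2 * n v + t * (J v - s\<^sup>2 * n v))" for t
      using min[of "\<lambda>i. u i + t * v i"] pu pv exp[of t] by (simp add: periodic_with_def)
    have "n v = 0"
    proof (rule ccontr)
      assume "n v \<noteq> 0"
      then have nv: "n v > 0" by (simp add: n_def less_le sum_nonneg)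
      define c where "c = J v - s\<^sup>2 * n v"
      have c: "c \<ge> 0" using min[OF pv] by (simp add: c_def)
      \<comment> \<open>Negative, and so small that the quadratic term cannot outweigh the linear
        one: \<open>\<bar>t\<bar> * c \<le> n v\<close>.\<close>
      define t where "t = - (n v / (c + 1))"
      have "t < 0" using nv c by (simp add: t_def)
      moreover have "n v / (c + 1) * c \<le> n v"
        using nv c by (simp add: divide_simps)
      then have "2 * n v + t * c > 0" using nv by (simp add: t_def)
      ultimately have "t * (2 * n v + t * c) < 0" by (rule mult_neg_pos)
      then show False using pos[of t] by (simp add: c_def)
    qed
    then have "v (i mod q) = 0"
      using q by (auto simp: n_def sum_nonneg_eq_0_iff)
    then have "v i = 0" using periodic_with_mod[OF pv] by simp
    then show ?thesis by (simp add: v_def)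
  qed
  have "u \<noteq> (\<lambda>_. 0)" using nu by (auto simp: n_def)
  moreover have "0 \<le> s" using J0 by (simp add: s_def)
  ultimately show ?thesis
    using pu crit min unfolding J_def n_def by blast
qed

text \<open>With \<open>G = H - E\<close> and the minimizer \<open>u\<close>,
  \<open>(G - s) (G + s) u = 0\<close>. Either \<open>(G + s) u\<close> vanishes and
  \<open>u\<close> belongs to \<open>E - s\<close>, or it is an eigenfunction for
  \<open>E + s\<close>. Comparison with the trial function \<open>v\<close> gives
  \<open>s \<le> d\<close>.\<close>

lemma periodic_eigenfunction:
  assumes w: "periodic_with q w" and q: "0 < q"
    and v: "periodic_with q v" "(\<Sum>i\<in>{0..<q}. (v i)\<^sup>2) > 0"
    and le: "(\<Sum>i\<in>{0..<q}. (hopping w E v i)\<^sup>2) \<le> d\<^sup>2 * (\<Sum>i\<in>{0..<q}. (v i)\<^sup>2)" and d: "0 \<le> d"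
  shows "\<exists>E' u. \<bar>E' - E\<bar> \<le> d \<and> periodic_with q u \<and> u \<noteq> (\<lambda>_. 0) \<and> (\<forall>i. hopping w E' u i = 0)"
proof -
  obtain u s where u: "periodic_with q u" "u \<noteq> (\<lambda>_. 0)" "0 \<le> s"
     "\<And>i. hopping w E (hopping w E u) i = s\<^sup>2 * u i"
     and min: "\<And>v. periodic_with q v \<Longrightarrow>
        s\<^sup>2 * (\<Sum>i\<in>{0..<q}. (v i)\<^sup>2) \<le> (\<Sum>i\<in>{0..<q}. (hopping w E v i)\<^sup>2)"
    using hopping_minimizer[OF w q] by blast
  have "s\<^sup>2 * (\<Sum>i\<in>{0..<q}. (v i)\<^sup>2) \<le> d\<^sup>2 * (\<Sum>i\<in>{0..<q}. (v i)\<^sup>2)"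
    using min[OF v(1)] le by simp
  then have "s \<le> d" using v(2) d by (simp add: power2_le_iff_abs_le)
  have sh: "hopping w (E + t) u i = hopping w E u i - t * u i" for t u i
    by (simp add: hopping_def algebra_simps)
  define x where "x i = hopping w E u i + s * u i" for i
  show ?thesis
  proof (cases "x = (\<lambda>_. 0)")
    case True
    then have "hopping w (E + (- s)) u i = 0" for i
      unfolding sh by (simp add: x_def fun_eq_iff)
    then show ?thesis using u \<open>s \<le> d\<close> by (intro exI[of _ "E + (- s)"] exI[of _ u]) auto
  next
    case False
    have "x = (\<lambda>i. hopping w E u i + s * u i)" by (simp add: x_def fun_eq_iff)
    then have "hopping w E x i = hopping w E (hopping w E u) i + s * hopping w E u i" for i
      by (simp add: hopping_linear)
    then have "hopping w (E + s) x i = 0" for i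
      unfolding sh by (simp add: u x_def algebra_simps power2_eq_square)
    moreover have "periodic_with q x"
      using u(1) periodic_hopping[OF w u(1)] by (simp add: x_def periodic_with_def)
    ultimately show ?thesis using u False \<open>s \<le> d\<close> by (intro exI[of _ "E + s"] exI[of _ x]) auto
  qed
qed

text \<open>Eigenvalue 1 and determinant 1 force trace 2, so the characteristic polynomial is
  \<open>(X - 1)\<^sup>2\<close>; the claim is Cayley-Hamilton.\<close>

lemma unipotent_2x2:
  fixes M :: "real^2^2"
  assumes det: "det M = 1" and v: "M *v v = v" "v \<noteq> 0"
  shows "(M - mat 1) ** (M - mat 1) = 0"
proof -
  have "\<not> invertible (M - mat 1)"
  proof
    assume "invertible (M - mat 1)"
    moreover have "(M - mat 1) *v v = 0"
      using v(1) by (simp add: matrix_vector_mult_diff_rdistrib)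
    ultimately show False
      using v(2) by (metis invertible_def matrix_vector_mul_assoc matrix_vector_mul_lid matrix_vector_mult_0_right)
  qed
  then have "det (M - mat 1) = 0" by (simp add: invertible_det_nz)
  then have tr: "M$1$1 + M$2$2 = 2" and dt: "M$1$1 * M$2$2 - M$1$2 * M$2$1 = 1"
    using det by (simp_all add: det_2 mat_def algebra_simps)
  then have m22: "M$2$2 = 2 - M$1$1" by simp
  show ?thesis using dt unfolding m22
    by (simp add: vec_eq_iff forall_2 matrix_matrix_mult_def sum_2 mat_def m22 algebra_simps)
qed

lemma unipotent_power:
  fixes M :: "real^2^2"
  assumes "(M - mat 1) ** (M - mat 1) = 0"
  shows "(((**) M) ^^ j) (mat 1) = mat 1 + real j *\<^sub>R (M - mat 1)"
proof (induction j)
  case (Suc j)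
  let ?N = "M - mat 1"
  have "M ** ?N = ?N + ?N ** ?N"
    by (simp add: vec_eq_iff forall_2 matrix_matrix_mult_def sum_2 mat_def algebra_simps)
  moreover have "M ** (mat 1 + c *\<^sub>R ?N) = M + c *\<^sub>R (M ** ?N)" for c
    by (simp add: vec_eq_iff forall_2 matrix_matrix_mult_def sum_2 mat_def algebra_simps)
  ultimately have "M ** (mat 1 + real j *\<^sub>R ?N) = M + real j *\<^sub>R ?N"
    using assms by simp
  also have "\<dots> = mat 1 + real (Suc j) *\<^sub>R ?N"
    by (simp add: algebra_simps)
  finally show ?case by (simp only: funpow.simps comp_apply Suc.IH)
qed simp

lemma transfer_matrix_periodic:
  assumes "periodic_with (int q) w"
  shows "transfer_matrix (j * q) E w = (((**) (transfer_matrix q E w)) ^^ j) (mat 1)"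
proof (induction j)
  case (Suc j)
  have "w (i + int (j * q)) = w i" for i
    using periodic_with_mult[OF assms, of i "int j"] by simp
  then have "transfer_matrix (q + j * q) E w = transfer_matrix q E w ** transfer_matrix (j * q) E w"
    by (subst transfer_matrix_add) simp
  then show ?case using Suc by simp
qed simp

text \<open>A periodic eigenfunction gives a vector fixed by the one-period matrix, which is then
  unipotent, so its powers grow linearly in \<open>j\<close>. The bound is uniform in the starting
  site \<open>t\<close>.\<close>

lemma onorm_transfer_matrix_periodic_le:
  assumes q: "0 < q" and w: "periodic_with (int q) w"
    and u: "periodic_with (int q) u" "u \<noteq> (\<lambda>_. 0)" "\<And>i. hopping w E u i = 0"
    and C: "\<And>i. \<bar>E - w i\<bar> + 2 \<le> C"
  shows "onorm ((*v) (transfer_matrix (j * q) E (\<lambda>i. w (i + t)))) \<le> 1 + real j * (C ^ q + 1)"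
proof -
  let ?w = "\<lambda>i. w (i + t)" and ?u = "\<lambda>i. u (i + t)"
  let ?M = "transfer_matrix q E ?w"
  have pw: "periodic_with (int q) ?w"
    using w unfolding periodic_with_def by (simp add: add.assoc add.commute[of _ t]) (simp add: add.assoc[symmetric])
  have eq: "?u (n + 1) + ?u (n - 1) + ?w n * ?u n = E * ?u n" for n
    using u(3)[of "n + t"] by (simp add: hopping_def algebra_simps)
  have "?u (int q) = ?u 0" "?u (int q - 1) = ?u (-1)"
    using u(1)[unfolded periodic_with_def, rule_format, of t]
      u(1)[unfolded periodic_with_def, rule_format, of "t - 1"] by (simp_all add: algebra_simps)
  then have fix_v: "?M *v vector [?u 0, ?u (-1)] = vector [?u 0, ?u (-1)]"
    using transfer_matrix_solution[of ?u ?w E q, OF eq] by (simp only:)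
  \<comment> \<open>Two consecutive zeros would propagate to all later sites and, by periodicity, to
    every site.\<close>
  have nz: "vector [?u 0, ?u (-1)] \<noteq> (0 :: real^2)"
  proof
    assume z: "vector [?u 0, ?u (-1)] = (0 :: real^2)"
    have "?u (int n) = 0" for n
    proof -
      have "vector [?u (int n), ?u (int n - 1)] = (0 :: real^2)"
        using transfer_matrix_solution[of ?u ?w E n, OF eq] z
        by (simp only: matrix_vector_mult_0_right)
      then have "(vector [?u (int n), ?u (int n - 1)] :: real^2) $ 1 = 0" by (simp only: zero_index)
      then show ?thesis by (simp only: vector_2)
    qed
    moreover have "\<exists>n. u i = ?u (int n)" for i
    proof -
      have "?u ((i - t) mod int q) = u i"
        using periodic_with_mult[OF u(1), of "(i - t) mod int q + t" "(i - t) div int q"]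
        by (simp add: algebra_simps)
      then show ?thesis using q by (intro exI[of _ "nat ((i - t) mod int q)"]) simp
    qed
    ultimately have "u = (\<lambda>_. 0)" by (intro ext) metis
    with u(2) show False ..
  qed
  have "(?M - mat 1) ** (?M - mat 1) = 0"
    by (rule unipotent_2x2[OF det_transfer_matrix fix_v nz])
  then have "transfer_matrix (j * q) E ?w = mat 1 + real j *\<^sub>R (?M - mat 1)"
    by (simp only: unipotent_power transfer_matrix_periodic[OF pw])
  then have "onorm ((*v) (transfer_matrix (j * q) E ?w))
      \<le> onorm ((*v) (mat 1 :: real^2^2)) + onorm ((*v) (real j *\<^sub>R (?M - mat 1)))"
    by (simp only: onorm_matrix_add_le)
  also have "\<dots> = 1 + real j * onorm ((*v) (?M + (-1) *\<^sub>R mat 1))"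
    by (simp only: onorm_mat_1 onorm_matrix_scaleR abs_of_nat) simp
  also have "onorm ((*v) (?M + (-1) *\<^sub>R mat 1)) \<le> onorm ((*v) ?M) + onorm ((*v) ((-1) *\<^sub>R (mat 1 :: real^2^2)))"
    by (rule onorm_matrix_add_le)
  also have "\<dots> \<le> C ^ q + 1"
    unfolding onorm_mat_1 onorm_matrix_scaleR using onorm_transfer_matrix_le[of q E ?w C, OF C] by linarith
  finally show ?thesis by (simp add: mult_left_mono)
qed

section \<open>Truncated plane waves\<close>

definition cut_wave :: "int \<Rightarrow> nat \<Rightarrow> real \<Rightarrow> int \<Rightarrow> complex" where
  "cut_wave a l \<theta> i = (if a \<le> i \<and> i < a + int l then cis (\<theta> * of_int i) else 0)"

text \<open>How far the cut wave is from an eigenfunction. The energy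
  \<open>c + 2 cos \<theta>\<close> is the one for which the full wave solves the equation with
  constant potential \<open>c\<close>, so the error sits at the cuts.\<close>

definition wave_defect :: "(int \<Rightarrow> real) \<Rightarrow> real \<Rightarrow> int \<Rightarrow> nat \<Rightarrow> real \<Rightarrow> int \<Rightarrow> complex" where
  "wave_defect V c a l \<theta> i = schroedinger V (cut_wave a l \<theta>) i
     - complex_of_real (c + 2 * cos \<theta>) * cut_wave a l \<theta> i"

lemma cis_recurrence:
  "cis (\<theta> * of_int (i + 1)) + cis (\<theta> * of_int (i - 1)) = complex_of_real (2 * cos \<theta>) * cis (\<theta> * of_int i)"
  by (simp add: complex_eq_iff algebra_simps cos_add cos_diff sin_add sin_diff)

lemma wave_defect_cases:
  assumes V: "\<And>i. a \<le> i \<Longrightarrow> i < a + int l \<Longrightarrow> V i = c"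
  shows "cmod (wave_defect V c a l \<theta> i) \<le> 2"
    and "i \<notin> {a - 1, a, a + int l - 1, a + int l} \<Longrightarrow> wave_defect V c a l \<theta> i = 0"
proof -
  let ?W = "cut_wave a l \<theta>"
  have n1: "cmod (?W j) \<le> 1" for j by (simp add: cut_wave_def)
  let ?c = "\<lambda>i. cis (\<theta> * of_int i)"
  have *: "cmod (wave_defect V c a l \<theta> i) \<le> 2 \<and>
    (i \<notin> {a - 1, a, a + int l - 1, a + int l} \<longrightarrow> wave_defect V c a l \<theta> i = 0)"
  proof (cases "a \<le> i \<and> i < a + int l")
    case True
    then have "wave_defect V c a l \<theta> i = ?W (i + 1) + ?W (i - 1) - complex_of_real (2 * cos \<theta>) * ?c i"
      using V by (simp add: wave_defect_def schroedinger_def cut_wave_def algebra_simps)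
    also have "\<dots> = (?W (i + 1) - ?c (i + 1)) + (?W (i - 1) - ?c (i - 1))"
      unfolding cis_recurrence[symmetric] by simp
    finally have eq: "wave_defect V c a l \<theta> i = (?W (i + 1) - ?c (i + 1)) + (?W (i - 1) - ?c (i - 1))" .
    have "cmod (?W j - ?c j) \<le> 1" for j by (simp add: cut_wave_def)
    then have "cmod (wave_defect V c a l \<theta> i) \<le> 1 + 1"
      unfolding eq by (intro norm_triangle_mono)
    moreover have "wave_defect V c a l \<theta> i = 0" if "i \<notin> {a - 1, a, a + int l - 1, a + int l}"
      unfolding eq using True that by (auto simp: cut_wave_def)
    ultimately show ?thesis by simp
  next
    case False
    then have eq: "wave_defect V c a l \<theta> i = ?W (i + 1) + ?W (i - 1)"
      by (auto simp: wave_defect_def schroedinger_def cut_wave_def)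
    have "cmod (wave_defect V c a l \<theta> i) \<le> 1 + 1"
      unfolding eq by (intro norm_triangle_mono n1)
    moreover have "wave_defect V c a l \<theta> i = 0" if "i \<notin> {a - 1, a, a + int l - 1, a + int l}"
      unfolding eq using False that by (auto simp: cut_wave_def)
    ultimately show ?thesis by simp
  qed
  from * show "cmod (wave_defect V c a l \<theta> i) \<le> 2"
    and "i \<notin> {a - 1, a, a + int l - 1, a + int l} \<Longrightarrow> wave_defect V c a l \<theta> i = 0" by auto
qed

text \<open>At most four sites next to the cuts contribute (they may coincide for short waves), each
  at most \<open>2\<^sup>2\<close>. The bound does not grow with \<open>l\<close>, whereas the
  squared norm of the wave is \<open>l\<close>; this is the origin of the distance
  \<open>4 / sqrt l\<close>.\<close>

lemma sum_wave_defect_le: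
  assumes V: "\<And>i. a \<le> i \<Longrightarrow> i < a + int l \<Longrightarrow> V i = c" and F: "finite F"
  shows "(\<Sum>i\<in>F. (cmod (wave_defect V c a l \<theta> i))\<^sup>2) \<le> 16"
proof -
  let ?B = "{a - 1, a, a + int l - 1, a + int l}"
  have "(\<Sum>i\<in>F. (cmod (wave_defect V c a l \<theta> i))\<^sup>2) = (\<Sum>i\<in>F \<inter> ?B. (cmod (wave_defect V c a l \<theta> i))\<^sup>2)"
    using wave_defect_cases(2)[where V = V, OF V] F
    by (intro sum.mono_neutral_cong_right) auto
  also have "\<dots> \<le> of_nat (card (F \<inter> ?B)) * 4"
  proof (rule sum_bounded_above)
    fix i assume "i \<in> F \<inter> ?B"
    have "(cmod (wave_defect V c a l \<theta> i))\<^sup>2 \<le> 2\<^sup>2"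
      using wave_defect_cases(1)[where V = V, OF V] by (intro power_mono) auto
    then show "(cmod (wave_defect V c a l \<theta> i))\<^sup>2 \<le> 4" by simp
  qed
  also have "card (F \<inter> ?B) \<le> 4"
  proof -
    have "card (F \<inter> ?B) \<le> card ?B" by (intro card_mono) auto
    also have "\<dots> \<le> 4" by (simp add: card_insert_if)
    finally show ?thesis .
  qed
  finally show ?thesis by simp
qed

lemma sum_cut_wave:
  assumes "finite F" "{a..<a + int l} \<subseteq> F"
  shows "(\<Sum>i\<in>F. (cmod (cut_wave a l \<theta> i))\<^sup>2) = real l"
proof -
  have "(\<Sum>i\<in>F. (cmod (cut_wave a l \<theta> i))\<^sup>2) = (\<Sum>i\<in>{a..<a + int l}. 1)"
    using assms by (intro sum.mono_neutral_cong_right) (auto simp: cut_wave_def)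
  then show ?thesis by simp
qed

text \<open>The trial function has to be real, so the periodized wave is split into real and
  imaginary part. Defects and norms add up over the two parts, so at least one of them has a nonzero
  norm and a quotient not exceeding \<open>16 / l\<close>.\<close>

lemma periodic_eigenfunction_near_patch:
  assumes w: "periodic_with q w" and patch: "\<And>i. a \<le> i \<Longrightarrow> i < a + int l \<Longrightarrow> w i = c"
    and a: "1 \<le> a" "a + int l < q" and l: "0 < l"
  shows "\<exists>E u. \<bar>E - (c + 2 * cos \<theta>)\<bar> \<le> 4 / sqrt (real l) \<and> periodic_with q u \<and>
    u \<noteq> (\<lambda>_. 0) \<and> (\<forall>i. hopping w E u i = 0)"
proof -
  let ?E = "c + 2 * cos \<theta>" and ?I = "{0..<q}"
  let ?W = "cut_wave a l \<theta>" and ?D = "wave_defect w c a l \<theta>"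
  have q: "0 < q" using a by simp
  have main: ?thesis
    if v: "periodic_with q v" "0 < (\<Sum>i\<in>?I. (v i)\<^sup>2)"
      and le: "(\<Sum>i\<in>?I. (hopping w ?E v i)\<^sup>2) \<le> 16 / real l * (\<Sum>i\<in>?I. (v i)\<^sup>2)" for v
  proof -
    have "(4 / sqrt (real l))\<^sup>2 = 16 / real l" using l by (simp add: power_divide)
    then show ?thesis
      using periodic_eigenfunction[OF w q v, of ?E "4 / sqrt (real l)"] le by auto
  qed
  define v1 where "v1 i = Re (?W (i mod q))" for i
  define v2 where "v2 i = Im (?W (i mod q))" for i
  have p: "periodic_with q v1" "periodic_with q v2"
    by (simp_all add: periodic_with_def v1_def v2_def)
  \<comment> \<open>The wave vanishes at \<open>0\<close> and at \<open>q - 1\<close>, so the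
    neighbours \<open>-1\<close> and \<open>q\<close> of the period see no copy of it.\<close>
  have md: "?W (i mod q) = ?W i" if "-1 \<le> i" "i \<le> q" for i
  proof -
    have "i = -1 \<or> i = q \<or> 0 \<le> i \<and> i < q" using that by arith
    then consider "i = -1" | "i = q" | "0 \<le> i" "i < q" by blast
    then show ?thesis
    proof cases
      case 1
      have "(-1) mod q = q - 1" using q by (simp add: zmod_minus1)
      then show ?thesis using 1 a by (simp add: cut_wave_def)
    qed (use a in \<open>auto simp: cut_wave_def\<close>)
  qed
  have h: "hopping w ?E v1 i = Re (?D i)" "hopping w ?E v2 i = Im (?D i)" if "i \<in> ?I" for i
  proof -
    have "?W ((i + 1) mod q) = ?W (i + 1)" "?W ((i - 1) mod q) = ?W (i - 1)" "?W (i mod q) = ?W i"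
      using that by (auto intro!: md)
    then show "hopping w ?E v1 i = Re (?D i)" "hopping w ?E v2 i = Im (?D i)"
      by (simp_all add: hopping_def v1_def v2_def wave_defect_def schroedinger_def algebra_simps)
  qed
  have "(\<Sum>i\<in>?I. (hopping w ?E v1 i)\<^sup>2) + (\<Sum>i\<in>?I. (hopping w ?E v2 i)\<^sup>2) = (\<Sum>i\<in>?I. (cmod (?D i))\<^sup>2)"
    using h by (simp add: cmod_power2 flip: sum.distrib)
  also have "\<dots> \<le> 16" by (rule sum_wave_defect_le) (use patch in auto)
  finally have J: "(\<Sum>i\<in>?I. (hopping w ?E v1 i)\<^sup>2) + (\<Sum>i\<in>?I. (hopping w ?E v2 i)\<^sup>2) \<le> 16" .
  have "(\<Sum>i\<in>?I. (v1 i)\<^sup>2) + (\<Sum>i\<in>?I. (v2 i)\<^sup>2) = (\<Sum>i\<in>?I. (cmod (?W i))\<^sup>2)"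
    by (simp add: v1_def v2_def cmod_power2 flip: sum.distrib)
  also have "\<dots> = real l" using a by (intro sum_cut_wave) auto
  finally have n: "(\<Sum>i\<in>?I. (v1 i)\<^sup>2) + (\<Sum>i\<in>?I. (v2 i)\<^sup>2) = real l" .
  have nn: "(\<Sum>i\<in>?I. (v1 i)\<^sup>2) \<ge> 0" "(\<Sum>i\<in>?I. (v2 i)\<^sup>2) \<ge> 0"
    "(\<Sum>i\<in>?I. (hopping w ?E v1 i)\<^sup>2) \<ge> 0" "(\<Sum>i\<in>?I. (hopping w ?E v2 i)\<^sup>2) \<ge> 0"
    by (simp_all add: sum_nonneg)
  have k: "16 / real l * (\<Sum>i\<in>?I. (v1 i)\<^sup>2) + 16 / real l * (\<Sum>i\<in>?I. (v2 i)\<^sup>2) = 16"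
    unfolding distrib_left[symmetric] n using l by simp
  show ?thesis
  proof (cases "(\<Sum>i\<in>?I. (v1 i)\<^sup>2) > 0 \<and>
      (\<Sum>i\<in>?I. (hopping w ?E v1 i)\<^sup>2) \<le> 16 / real l * (\<Sum>i\<in>?I. (v1 i)\<^sup>2)")
    case True then show ?thesis using main p by blast
  next
    case False
    have "(\<Sum>i\<in>?I. (v2 i)\<^sup>2) > 0 \<and>
      (\<Sum>i\<in>?I. (hopping w ?E v2 i)\<^sup>2) \<le> 16 / real l * (\<Sum>i\<in>?I. (v2 i)\<^sup>2)"
    proof (cases "(\<Sum>i\<in>?I. (v1 i)\<^sup>2) > 0")
      case True
      with False have "(\<Sum>i\<in>?I. (hopping w ?E v1 i)\<^sup>2) > 16 / real l * (\<Sum>i\<in>?I. (v1 i)\<^sup>2)" by simp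
      then have lt: "(\<Sum>i\<in>?I. (hopping w ?E v2 i)\<^sup>2) < 16 / real l * (\<Sum>i\<in>?I. (v2 i)\<^sup>2)"
        using J k by linarith
      then have "(\<Sum>i\<in>?I. (v2 i)\<^sup>2) \<noteq> 0" using nn(4) by auto
      then show ?thesis using lt nn by linarith
    next
      case False
      then have z: "(\<Sum>i\<in>?I. (v1 i)\<^sup>2) = 0" using nn by linarith
      then show ?thesis using n k J nn l by auto
    qed
    then show ?thesis using main p by blast
  qed
qed

lemma ell2_norm_finite_support:
  assumes "finite F" "\<And>i. i \<notin> F \<Longrightarrow> u i = 0"
  shows "u \<in> ell2" "ell2_norm u = sqrt (\<Sum>i\<in>F. (cmod (u i))\<^sup>2)"
proof -
  have "((\<lambda>n. (cmod (u n))\<^sup>2) has_sum (\<Sum>i\<in>F. (cmod (u i))\<^sup>2)) F"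
    by (rule has_sum_finite[OF assms(1)])
  then have "((\<lambda>n. (cmod (u n))\<^sup>2) has_sum (\<Sum>i\<in>F. (cmod (u i))\<^sup>2)) UNIV"
    by (rule has_sum_cong_neutral[THEN iffD1, rotated -1]) (use assms(2) in auto)
  then show "u \<in> ell2" "ell2_norm u = sqrt (\<Sum>i\<in>F. (cmod (u i))\<^sup>2)"
    by (auto simp: ell2_def ell2_norm_def summable_on_def dest: infsumI)
qed

text \<open>Weyl's criterion: a wave of norm \<open>sqrt l\<close> is mapped to a vector of norm at
  most 4, so a resolvent bound \<open>C\<close> would give
  \<open>sqrt l \<le> 4 * \<bar>C\<bar>\<close> for every \<open>l\<close>.\<close>

lemma schroedinger_spectrum_if_long_patches:
  assumes patches: "\<And>l::nat. \<exists>a. \<forall>i. a \<le> i \<and> i < a + int l \<longrightarrow> V i = c"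
  shows "complex_of_real (c + 2 * cos \<theta>) \<in> ell2_spectrum (schroedinger V)"
proof (rule ccontr)
  let ?z = "complex_of_real (c + 2 * cos \<theta>)"
  let ?A = "\<lambda>u n. schroedinger V u n - ?z * u n"
  assume "?z \<notin> ell2_spectrum (schroedinger V)"
  then obtain C where bij: "bij_betw ?A ell2 ell2"
    and C: "\<And>v. v \<in> ell2 \<Longrightarrow> ell2_norm (inv_into ell2 ?A v) \<le> C * ell2_norm v"
    by (auto simp: ell2_spectrum_def ell2_resolvent_set_def)
  obtain l :: nat where l: "real l > (4 * \<bar>C\<bar>)\<^sup>2" using reals_Archimedean2 by blast
  obtain a where a: "\<And>i. a \<le> i \<Longrightarrow> i < a + int l \<Longrightarrow> V i = c" using patches[of l] by blast
  let ?W = "cut_wave a l \<theta>" and ?D = "wave_defect V c a l \<theta>"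
  have W: "?W \<in> ell2" "ell2_norm ?W = sqrt (real l)"
    using ell2_norm_finite_support[of "{a..<a + int l}" ?W] sum_cut_wave[of "{a..<a + int l}" a l \<theta>]
    by (auto simp: cut_wave_def)
  have D: "?D = ?A ?W" by (simp add: wave_defect_def fun_eq_iff)
  have nD: "?D \<in> ell2" "ell2_norm ?D \<le> 4"
  proof -
    note ell2_norm_finite_support[of "{a - 1, a, a + int l - 1, a + int l}" ?D]
    note * = this[OF _ wave_defect_cases(2)[where V = V, OF a]]
    show "?D \<in> ell2" by (rule *(1)) auto
    have "ell2_norm ?D = sqrt (\<Sum>i\<in>{a - 1, a, a + int l - 1, a + int l}. (cmod (?D i))\<^sup>2)"
      by (rule *(2)) auto
    also have "\<dots> \<le> sqrt 16" by (intro real_sqrt_le_mono sum_wave_defect_le[where V = V, OF a]) auto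
    finally show "ell2_norm ?D \<le> 4" by simp
  qed
  have "inv_into ell2 ?A ?D = ?W"
    unfolding D using inv_into_f_f[OF bij_betw_imp_inj_on[OF bij] W(1)] by simp
  then have "sqrt (real l) \<le> C * ell2_norm ?D"
    using C[OF nD(1)] W(2) by simp
  also have "\<dots> \<le> \<bar>C\<bar> * 4"
    using nD(2) by (intro mult_mono) (auto simp: ell2_norm_def infsum_nonneg)
  finally have "(sqrt (real l))\<^sup>2 \<le> (\<bar>C\<bar> * 4)\<^sup>2" by (intro power_mono) auto
  then show False using l by (simp add: mult.commute)
qed

section \<open>The dyadic odometer\<close>

text \<open>Haar measure of the 2-adic integers, written in binary digits with the least significant
  first.\<close>

definition coin_space :: "(nat \<Rightarrow> bool) measure" where
  "coin_space = PiM UNIV (\<lambda>_. measure_pmf (bernoulli_pmf (1/2)))"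

text \<open>Addition of 1 with carry: a digit flips exactly when all lower digits are 1.\<close>

definition odometer :: "(nat \<Rightarrow> bool) \<Rightarrow> nat \<Rightarrow> bool" where
  "odometer x n = (if \<forall>m<n. x m then \<not> x n else x n)"

text \<open>The 2-adic integer modulo \<open>2 ^ k\<close>. It turns the odometer into modular
  arithmetic and cylinder sets into residue classes.\<close>

definition residue :: "nat \<Rightarrow> (nat \<Rightarrow> bool) \<Rightarrow> nat" where
  "residue k x = (\<Sum>i<k. of_bool (x i) * 2 ^ i)"

lemma residue_Suc: "residue (Suc k) x = residue k x + of_bool (x k) * 2 ^ k"
  by (simp add: residue_def)

lemma residue_less: "residue k x < 2 ^ k"
proof (induction k)
  case (Suc k)
  then show ?case by (cases "x k") (simp_all add: residue_Suc)
qed (simp add: residue_def)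

lemma residue_mod:
  assumes "k \<le> j"
  shows "residue j x mod 2 ^ k = residue k x"
  using assms
proof (induction j rule: dec_induct)
  case (step j)
  then have "(2::nat) ^ k dvd 2 ^ j" by (intro le_imp_power_dvd) simp
  then obtain c :: nat where c: "2 ^ j = 2 ^ k * c" ..
  have "(residue j x + of_bool (x j) * 2 ^ j) mod 2 ^ k = residue j x mod 2 ^ k"
    by (cases "x j") (simp_all add: c)
  then show ?case using step by (simp add: residue_Suc)
qed (simp add: residue_less)

lemma residue_eq_iff: "residue k x = residue k y \<longleftrightarrow> (\<forall>i<k. x i = y i)"
proof
  assume eq: "residue k x = residue k y"
  show "\<forall>i<k. x i = y i"
  proof (intro allI impI)
    fix i assume i: "i < k"
    have s: "residue (Suc i) x = residue (Suc i) y" and e: "residue i x = residue i y"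
      using eq i residue_mod[of "Suc i" k, symmetric] residue_mod[of i k, symmetric] by simp_all
    then show "x i = y i" by (simp add: residue_Suc of_bool_eq_iff)
  qed
qed (simp add: residue_def)

lemma residue_full: "residue k x = 2 ^ k - 1 \<longleftrightarrow> (\<forall>i<k. x i)"
proof -
  have "residue k (\<lambda>_. True) = 2 ^ k - 1" by (induction k) (simp_all add: residue_Suc residue_def[of 0])
  then show ?thesis using residue_eq_iff[of k x "\<lambda>_. True"] by simp
qed

lemma residue_odometer: "residue k (odometer x) = (residue k x + 1) mod 2 ^ k"
proof (induction k)
  case (Suc k)
  show ?case
  proof (cases "\<forall>i<k. x i")
    case True
    then have r: "residue k x = 2 ^ k - 1" by (rule residue_full[THEN iffD2])
    then have "residue k (odometer x) = 0" using Suc by simp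
    moreover have "odometer x k = (\<not> x k)" using True by (simp add: odometer_def)
    moreover have "(2 ^ k + 2 ^ k) mod (2 * 2 ^ k) = (0 :: nat)"
      by (metis mod_self mult_2)
    ultimately show ?thesis using r by (cases "x k") (simp_all add: residue_Suc)
  next
    case False
    then have "residue k x \<noteq> 2 ^ k - 1" using residue_full[of k x] by blast
    then have "residue k x + 1 < 2 ^ k" using residue_less[of k x] by linarith
    moreover have "odometer x k = x k" using False by (auto simp: odometer_def)
    ultimately show ?thesis using Suc by (simp add: residue_Suc)
  qed
qed (simp add: residue_def)

lemma residue_odometer_funpow: "residue k ((odometer ^^ n) x) = (residue k x + n) mod 2 ^ k"
proof (induction n)
  case (Suc n)
  then show ?case by (simp add: residue_odometer mod_Suc_eq)
qed (simp add: residue_less)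

lemma residue_surj:
  assumes "r < 2 ^ k"
  shows "\<exists>x. residue k x = r"
  using assms
proof (induction k arbitrary: r)
  case (Suc k)
  have "r mod 2 ^ k < 2 ^ k" by simp
  then obtain x where x: "residue k x = r mod 2 ^ k" using Suc.IH by blast
  define y where "y = x(k := r div 2 ^ k = 1)"
  have "residue k y = residue k x" unfolding residue_eq_iff by (simp add: y_def)
  moreover have "r div 2 ^ k < 2" using Suc.prems by (simp add: less_mult_imp_div_less mult.commute)
  then have "r div 2 ^ k = of_bool (r div 2 ^ k = 1)" by auto
  ultimately have "residue (Suc k) y = r mod 2 ^ k + r div 2 ^ k * 2 ^ k"
    using x by (simp add: residue_Suc y_def)
  then show ?case by (metis mod_div_mult_eq)
qed (simp add: residue_def)

section \<open>Residue classes as generators of the coin measure\<close>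

interpretation coin: prob_space coin_space
  unfolding coin_space_def by (intro prob_space_PiM prob_space_measure_pmf)

lemma space_coin_space [simp]: "space coin_space = UNIV"
  by (simp add: coin_space_def space_PiM)

definition residue_class :: "nat \<Rightarrow> nat \<Rightarrow> (nat \<Rightarrow> bool) set" where
  "residue_class k r = {x. residue k x = r}"

lemma residue_class_emb:
  "residue_class k (residue k y) = prod_emb UNIV (\<lambda>_. measure_pmf (bernoulli_pmf (1/2))) {..<k} (\<Pi>\<^sub>E i\<in>{..<k}. {y i})"
  by (rule set_eqI) (simp add: residue_class_def residue_eq_iff prod_emb_iff PiE_iff Ball_def)

lemma sets_residue_class [measurable]: "residue_class k r \<in> sets coin_space"
proof (cases "r < 2 ^ k")
  case True
  then obtain y where "residue k y = r" using residue_surj by blast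
  then show ?thesis
    using residue_class_emb[of k y] unfolding coin_space_def by (auto intro!: sets_PiM_I_finite)
next
  case False
  then have "residue_class k r = {}" using residue_less by (auto simp: residue_class_def)
  then show ?thesis by simp
qed

lemma prob_residue_class:
  assumes "r < 2 ^ k"
  shows "measure coin_space (residue_class k r) = 1 / 2 ^ k"
proof -
  obtain y where y: "residue k y = r" using residue_surj[OF assms] by blast
  have "emeasure coin_space (residue_class k (residue k y)) = (\<Prod>i<k. emeasure (measure_pmf (bernoulli_pmf (1/2))) {y i})"
    unfolding residue_class_emb coin_space_def
    by (rule emeasure_PiM_emb) (auto intro: prob_space_measure_pmf)
  also have "\<dots> = (\<Prod>i<k. ennreal (1 / 2))"
    by (intro prod.cong refl, rename_tac i, case_tac "y i") (simp_all add: emeasure_pmf_single)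
  also have "\<dots> = ennreal (1 / 2 ^ k)"
    by (subst prod_ennreal) (simp_all add: power_divide)
  finally show ?thesis using y by (simp add: measure_def)
qed

definition residue_classes :: "(nat \<Rightarrow> bool) set set" where
  "residue_classes = {residue_class k r | k r. True}"

lemma Int_stable_residue_classes: "Int_stable residue_classes"
proof -
  have *: "residue_class k r \<inter> residue_class j s \<in> residue_classes" if "k \<le> j" for k j r s
  proof (cases "s mod 2 ^ k = r")
    case True
    then have "residue_class k r \<inter> residue_class j s = residue_class j s"
      using residue_mod[OF that] by (auto simp: residue_class_def)
    then show ?thesis by (auto simp: residue_classes_def)
  next
    case False
    \<comment> \<open>Two residue classes are nested or disjoint; \<open>residue_class 0 1\<close>
      serves as a name for the empty set, since \<open>residue 0\<close> is always
      \<open>0\<close>.\<close>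
    then have "residue_class k r \<inter> residue_class j s = residue_class 0 1"
      using residue_mod[OF that] by (auto simp: residue_class_def residue_def[of 0])
    then show ?thesis by (auto simp: residue_classes_def)
  qed
  show ?thesis
    unfolding Int_stable_def
  proof (intro ballI)
    fix A B assume "A \<in> residue_classes" "B \<in> residue_classes"
    then obtain k r j s where "A = residue_class k r" "B = residue_class j s"
      by (auto simp: residue_classes_def)
    then show "A \<inter> B \<in> residue_classes"
      using *[of k j r s] *[of j k s r] by (cases "k \<le> j") (auto simp: Int_commute)
  qed
qed

lemma sets_coin_space: "sets coin_space = sigma_sets UNIV residue_classes"
proof
  show "sigma_sets UNIV residue_classes \<subseteq> sets coin_space"
  proof -
    have "residue_classes \<subseteq> sets coin_space" by (auto simp: residue_classes_def)
    then show ?thesis using sets.sigma_sets_subset[of residue_classes coin_space] by simp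
  qed
  interpret S: sigma_algebra UNIV "sigma_sets UNIV residue_classes"
    by (rule sigma_algebra_sigma_sets) simp
  have single: "{x. x i} \<in> sigma_sets UNIV residue_classes" for i :: nat
  proof -
    have "x i \<longleftrightarrow> 2 ^ i \<le> residue (Suc i) x" for x
      using residue_less[of i x] by (cases "x i") (simp_all add: residue_Suc)
    then have "{x. x i} = (\<Union>r\<in>{2^i..<2^Suc i}. residue_class (Suc i) r)"
      using residue_less[of "Suc i"] by (auto simp: residue_class_def)
    also have "\<dots> \<in> sigma_sets UNIV residue_classes"
      by (intro S.finite_UN) (auto simp: residue_classes_def)
    finally show ?thesis .
  qed
  have all: "{x. x i \<in> A} \<in> sigma_sets UNIV residue_classes" for i :: nat and A :: "bool set"
  proof -
    have "{x. x i \<in> A} = (if True \<in> A then {x. x i} else {}) \<union> (if False \<in> A then UNIV - {x. x i} else {})"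
      by (auto split: if_splits) (metis (full_types))+
    also have "\<dots> \<in> sigma_sets UNIV residue_classes"
      using single[of i] by (intro S.Un) auto
    finally show ?thesis .
  qed
  show "sets coin_space \<subseteq> sigma_sets UNIV residue_classes"
  proof -
    have "{{f. f i \<in> A} | i A. True} \<subseteq> sigma_sets UNIV residue_classes"
      using all by auto
    then have "sigma_sets UNIV {{f. f i \<in> A} | i A. True} \<subseteq> sigma_sets UNIV residue_classes"
      by (rule S.sigma_sets_subset)
    then show ?thesis
      by (simp add: coin_space_def sets_PiM_single PiE_def space_PiM)
  qed
qed

text \<open>Dynkin's theorem as an induction rule; the empty set needs no case of its own, being a
  residue class.\<close>

lemma coin_space_induct [consumes 1, case_names basic compl union]:
  assumes "A \<in> sets coin_space"
    and basic: "\<And>k r. P (residue_class k r)"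
    and compl: "\<And>A. A \<in> sets coin_space \<Longrightarrow> P A \<Longrightarrow> P (- A)"
    and union: "\<And>A :: nat \<Rightarrow> _. disjoint_family A \<Longrightarrow> range A \<subseteq> sets coin_space \<Longrightarrow> (\<And>i. P (A i)) \<Longrightarrow> P (\<Union>i. A i)"
  shows "P A"
proof -
  have "residue_class 0 1 = {}" by (simp add: residue_class_def residue_def)
  then have "P {}" using basic[of 0 1] by simp
  show ?thesis
  proof (rule sigma_sets_induct_disjoint[OF Int_stable_residue_classes, of UNIV A P])
    show "A \<in> sigma_sets UNIV residue_classes" using assms(1) by (simp add: sets_coin_space)
    show "P (UNIV - B)" if "B \<in> sigma_sets UNIV residue_classes" "P B" for B
      using that compl[of B] by (simp add: sets_coin_space Compl_eq_Diff_UNIV)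
    show "P (\<Union>i. B i)" if "disjoint_family B" "range B \<subseteq> sigma_sets UNIV residue_classes" "\<And>i. P (B i)"
      for B :: "nat \<Rightarrow> _"
      using that union[of B] by (simp add: sets_coin_space)
  qed (use basic \<open>P {}\<close> in \<open>auto simp: residue_classes_def\<close>)
qed

section \<open>Invariance and ergodicity of the odometer\<close>

lemma odometer_vimage_residue_class:
  assumes "r < 2 ^ k"
  shows "odometer -` residue_class k ((r + 1) mod 2 ^ k) = residue_class k r"
proof -
  have "(a + 1) mod 2 ^ k = (r + 1) mod 2 ^ k \<longleftrightarrow> a = r" if "a < 2 ^ k" for a :: nat
    using that assms by (auto simp: mod_Suc split: if_splits)
  then show ?thesis using residue_less[of k] by (auto simp: residue_class_def residue_odometer)
qed

lemma odometer_vimage_basic: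
  "\<exists>s. odometer -` residue_class k r = residue_class k s \<and> (s < 2 ^ k \<longleftrightarrow> r < 2 ^ k)"
proof (cases "r < 2 ^ k")
  case True
  \<comment> \<open>This is \<open>r - 1\<close> modulo \<open>2 ^ k\<close>, written without a
    truncating subtraction.\<close>
  define s where "s = (r + (2 ^ k - 1)) mod 2 ^ k"
  have "(s + 1) mod 2 ^ k = r" "s < 2 ^ k" using True by (simp_all add: s_def mod_simps)
  then show ?thesis using odometer_vimage_residue_class[of s k] True by blast
next
  case False
  then have "residue_class k r = {}" using residue_less by (auto simp: residue_class_def)
  then show ?thesis using False by (intro exI[of _ r]) simp
qed

lemma measurable_odometer [measurable]: "odometer \<in> measurable coin_space coin_space"
proof (rule measurable_sigma_sets[OF sets_coin_space])
  fix A assume "A \<in> residue_classes"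
  then show "odometer -` A \<inter> space coin_space \<in> sets coin_space"
    using odometer_vimage_basic by (auto simp: residue_classes_def) (metis sets_residue_class)
qed auto

lemma measure_odometer_vimage:
  assumes "A \<in> sets coin_space"
  shows "measure coin_space (odometer -` A) = measure coin_space A"
  using assms
proof (induction rule: coin_space_induct)
  case (basic k r)
  obtain s where s: "odometer -` residue_class k r = residue_class k s" "s < 2 ^ k \<longleftrightarrow> r < 2 ^ k"
    using odometer_vimage_basic by blast
  show ?case
  proof (cases "r < 2 ^ k")
    case False
    then have "residue_class k r = {}" using residue_less by (auto simp: residue_class_def)
    then show ?thesis by simp
  qed (use s in \<open>simp add: prob_residue_class\<close>)
next
  case (compl A)
  have m: "odometer -` A \<in> sets coin_space" using measurable_sets[OF measurable_odometer compl(1)] by simp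
  have "measure coin_space (- A) = 1 - measure coin_space A"
    using coin.prob_compl[OF compl(1)] by (simp add: Compl_eq_Diff_UNIV)
  moreover have "measure coin_space (- odometer -` A) = 1 - measure coin_space (odometer -` A)"
    using coin.prob_compl[OF m] by (simp add: Compl_eq_Diff_UNIV)
  ultimately show ?case using compl by (simp add: vimage_Compl)
next
  case (union A)
  have m: "odometer -` A i \<in> sets coin_space" for i
    using measurable_sets[OF measurable_odometer, of "A i"] union(2) by auto
  have "(\<lambda>i. measure coin_space (odometer -` A i)) sums measure coin_space (\<Union>i. odometer -` A i)"
    using m union(1) by (intro coin.finite_measure_UNION) (auto simp: disjoint_family_on_def)
  moreover have "(\<lambda>i. measure coin_space (A i)) sums measure coin_space (\<Union>i. A i)"
    using union by (intro coin.finite_measure_UNION) auto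
  ultimately show ?case using union(3) by (simp add: vimage_UN sums_unique2)
qed

lemma measurable_odometer_funpow [measurable]: "odometer ^^ n \<in> measurable coin_space coin_space"
proof (induction n)
  case (Suc n)
  then show ?case using measurable_comp[OF Suc measurable_odometer] by simp
qed (simp add: measurable_ident)

lemma sets_odometer_vimage [measurable]: "A \<in> sets coin_space \<Longrightarrow> (odometer ^^ n) -` A \<in> sets coin_space"
  using measurable_sets[OF measurable_odometer_funpow, of A n] by simp

lemma prob_odometer_funpow_vimage:
  "A \<in> sets coin_space \<Longrightarrow> measure coin_space ((odometer ^^ n) -` A) = measure coin_space A"
proof (induction n)
  case (Suc n)
  have eq: "(odometer ^^ Suc n) -` A = odometer -` ((odometer ^^ n) -` A)"
    by (simp add: vimage_comp funpow_Suc_right del: funpow.simps)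
  show ?case
    unfolding eq using Suc measure_odometer_vimage[OF sets_odometer_vimage[OF Suc.prems, of n]] by simp
qed simp

text \<open>The odometer permutes the classes modulo \<open>2 ^ k\<close> cyclically, so an
  invariant set meets all of them in equal measure. It is thus independent of every residue class,
  hence of every measurable set, in particular of itself.\<close>

lemma odometer_ergodic:
  assumes A: "A \<in> sets coin_space" and inv: "odometer -` A = A"
  shows "measure coin_space A = 0 \<or> measure coin_space A = 1"
proof -
  let ?m = "measure coin_space"
  have indep: "?m (A \<inter> B) = ?m A * ?m B" if "B \<in> sets coin_space" for B
    using that
  proof (induction rule: coin_space_induct)
    case (basic k r)
    show ?case
    proof (cases "r < 2 ^ k")
      case True
      define a where "a = ?m (A \<inter> residue_class k 0)"
      have eq: "?m (A \<inter> residue_class k s) = a" if "s < 2 ^ k" for s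
        using that
      proof (induction s)
        case (Suc s)
        have "odometer -` (A \<inter> residue_class k (Suc s)) = A \<inter> residue_class k s"
          using odometer_vimage_residue_class[of s k] Suc.prems inv by (simp add: vimage_Int)
        then have "?m (A \<inter> residue_class k (Suc s)) = ?m (A \<inter> residue_class k s)"
          using measure_odometer_vimage[of "A \<inter> residue_class k (Suc s)"] A by simp
        then show ?case using Suc by simp
      qed (simp add: a_def)
      have "A = (\<Union>s\<in>{..<2 ^ k}. A \<inter> residue_class k s)"
        using residue_less[of k] by (auto simp: residue_class_def)
      then have "?m A = ?m (\<Union>s\<in>{..<2 ^ k}. A \<inter> residue_class k s)" by simp
      also have "\<dots> = (\<Sum>s\<in>{..<2 ^ k}. ?m (A \<inter> residue_class k s))"
      proof (rule coin.finite_measure_finite_Union)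
        show "disjoint_family_on (\<lambda>s. A \<inter> residue_class k s) {..<2 ^ k}"
          by (auto simp: disjoint_family_on_def residue_class_def)
      qed (use A in auto)
      also have "\<dots> = 2 ^ k * a" using eq by simp
      finally show ?thesis using eq[OF True] prob_residue_class[OF True] by simp
    next
      case False
      then have "residue_class k r = {}" using residue_less by (auto simp: residue_class_def)
      then show ?thesis by simp
    qed
  next
    case (compl B)
    have "?m (A \<inter> - B) = ?m A - ?m (A \<inter> B)"
      using A compl(1) by (simp add: coin.finite_measure_Diff' flip: Diff_eq)
    moreover have "?m (- B) = 1 - ?m B"
      using coin.prob_compl[OF compl(1)] by (simp add: Compl_eq_Diff_UNIV)
    ultimately show ?case using compl(2) by (simp only: right_diff_distrib mult_1_right)
  next
    case (union B)
    have "(\<lambda>i. ?m (A \<inter> B i)) sums ?m (\<Union>i. A \<inter> B i)"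
      using union A by (intro coin.finite_measure_UNION) (auto simp: disjoint_family_on_def)
    moreover have "(\<lambda>i. ?m A * ?m (B i)) sums (?m A * ?m (\<Union>i. B i))"
      using union by (intro sums_mult coin.finite_measure_UNION) auto
    ultimately show ?case using union(3) by (simp add: sums_unique2)
  qed
  have "?m A = ?m A * ?m A" using indep[OF A] by simp
  then show ?thesis by simp
qed

section \<open>Hierarchical potentials\<close>

text \<open>\<open>\<beta>\<close> is an upper bound for the total measure of all sites modified at later stages, and \<open>2 ^ e\<close>
  is the period of \<open>w\<close>.\<close>
definition stage :: "nat \<Rightarrow> nat \<Rightarrow> (int \<Rightarrow> real) \<Rightarrow> real \<Rightarrow> nat \<Rightarrow> bool" where
  "stage l e w \<beta> N \<longleftrightarrow>
     periodic_with (2 ^ e) w \<and> (\<forall>i. w i = 2 \<or> w i = - 2) \<and> 4 * l < 2 ^ e \<and>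
     (\<forall>i. 2 ^ e - 4 * int l \<le> i \<and> i < 2 ^ e - 2 * int l \<longrightarrow> w i = 2) \<and>
     (\<forall>i. 2 ^ e - 2 * int l \<le> i \<and> i < 2 ^ e \<longrightarrow> w i = - 2) \<and>
     0 < \<beta> \<and> 1 \<le> N \<and> real N * \<beta> \<le> 1 / real l \<and> real (4 * l) * \<beta> < 1 / 2 ^ e \<and>
     (\<forall>E0\<in>{-4..4}. \<exists>E. \<bar>E - E0\<bar> \<le> 4 / sqrt (real l) \<and>
        (\<forall>t. ln (onorm ((*v) (transfer_matrix N E (\<lambda>i. w (i + t))))) \<le> real N * (1 / real l)))"

lemma linear_growth_slow:
  fixes c d :: real
  assumes "0 < c" "0 < d"
  shows "\<exists>j\<ge>1::nat. ln (1 + real j * c) \<le> d * real j"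
proof -
  have "((\<lambda>j. ln (1 + real j * c) / real j) \<longlongrightarrow> 0) sequentially"
    using assms by real_asymp
  then have "eventually (\<lambda>j. ln (1 + real j * c) / real j < d) sequentially"
    using assms(2) by (rule order_tendstoD)
  then have "eventually (\<lambda>j. ln (1 + real j * c) / real j < d \<and> j \<ge> 1) sequentially"
    using eventually_ge_at_top[of 1] by eventually_elim auto
  then obtain j :: nat where "ln (1 + real j * c) / real j < d" "j \<ge> 1"
    using eventually_happens by force
  then show ?thesis by (intro exI[of _ j]) (auto simp: field_simps)
qed

text \<open>The sign of \<open>E0\<close> selects the patch, so that \<open>(E0 - c) / 2\<close> is
  the cosine of some \<open>\<theta>\<close>. The window is a whole number \<open>j\<close> of
  periods; one \<open>j\<close> serves all energies because the growth bound depends only on the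
  period and on \<open>?C\<close>.\<close>

lemma stage_energies:
  fixes l e :: nat
  assumes w: "periodic_with (2 ^ e) w" "\<And>i. w i = 2 \<or> w i = - 2" and l: "1 \<le> l" "4 * l < 2 ^ e"
    and plus: "\<And>i. 2 ^ e - 4 * int l \<le> i \<Longrightarrow> i < 2 ^ e - 2 * int l \<Longrightarrow> w i = 2"
    and minus: "\<And>i. 2 ^ e - 2 * int l \<le> i \<Longrightarrow> i < 2 ^ e \<Longrightarrow> w i = - 2"
  shows "\<exists>N\<ge>1. \<forall>E0\<in>{-4..4}. \<exists>E. \<bar>E - E0\<bar> \<le> 4 / sqrt (real l) \<and>
        (\<forall>t. ln (onorm ((*v) (transfer_matrix N E (\<lambda>i. w (i + t))))) \<le> real N * (1 / real l))"
proof -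
  \<comment> \<open>The energies found satisfy \<open>\<bar>E\<bar> \<le> 4 + 4\<close>; the letters
    and the one-step matrix add 2 each.\<close>
  let ?q = "2 ^ e :: nat" and ?C = "12 :: real"
  have l': "4 * int l < 2 ^ e" using l(2) by (metis of_nat_less_iff of_nat_mult of_nat_numeral of_nat_power)
  obtain j :: nat where j: "j \<ge> 1" "ln (1 + real j * (?C ^ ?q + 1)) \<le> (real ?q / real l) * real j"
    using linear_growth_slow[of "?C ^ ?q + 1" "real ?q / real l"] l by (auto simp: add_pos_pos)
  have "\<exists>E. \<bar>E - E0\<bar> \<le> 4 / sqrt (real l) \<and>
      (\<forall>t. ln (onorm ((*v) (transfer_matrix (j * ?q) E (\<lambda>i. w (i + t))))) \<le> real (j * ?q) * (1 / real l))"
    if E0: "E0 \<in> {-4..4}" for E0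
  proof -
    define c :: real where "c = (if E0 \<ge> 0 then 2 else - 2)"
    define a :: int where "a = (if E0 \<ge> 0 then 2 ^ e - 4 * int l else 2 ^ e - 2 * int l)"
    define \<theta> where "\<theta> = arccos ((E0 - c) / 2)"
    have th: "c + 2 * cos \<theta> = E0"
    proof -
      have "cos \<theta> = (E0 - c) / 2"
        unfolding \<theta>_def using E0 by (intro cos_arccos) (auto simp: c_def)
      then show ?thesis by simp
    qed
    have patch: "w i = c" if "a \<le> i" "i < a + int l" for i
      using that l plus[of i] minus[of i] by (auto simp: a_def c_def split: if_splits)
    \<comment> \<open>Each patch has length \<open>2 * l\<close> but the wave fills only its first
      half, so even the wave on the last patch stays clear of the end of the period.\<close>
    have a: "1 \<le> a" "a + int l < 2 ^ e" using l l' by (auto simp: a_def)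
    obtain E u where E: "\<bar>E - E0\<bar> \<le> 4 / sqrt (real l)"
      and u: "periodic_with (2 ^ e) u" "u \<noteq> (\<lambda>_. 0)" "\<And>i. hopping w E u i = 0"
      using periodic_eigenfunction_near_patch[OF w(1) patch a, of \<theta>] l th by auto
    have "4 / sqrt (real l) \<le> 4" using l by (simp add: divide_le_eq)
    then have "\<bar>E\<bar> \<le> 8" using E E0 by auto
    then have C: "\<bar>E - w i\<bar> + 2 \<le> ?C" for i using w(2)[of i] by auto
    have "ln (onorm ((*v) (transfer_matrix (j * ?q) E (\<lambda>i. w (i + t))))) \<le> real (j * ?q) * (1 / real l)" for t
    proof -
      have "onorm ((*v) (transfer_matrix (j * ?q) E (\<lambda>i. w (i + t)))) \<le> 1 + real j * (?C ^ ?q + 1)"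
        using u(1,2) w(1) by (intro onorm_transfer_matrix_periodic_le[of ?q w u] u(3) C) auto
      then have "ln (onorm ((*v) (transfer_matrix (j * ?q) E (\<lambda>i. w (i + t))))) \<le> ln (1 + real j * (?C ^ ?q + 1))"
        using onorm_transfer_matrix_ge_1[of "j * ?q" E "\<lambda>i. w (i + t)"] by (intro ln_mono) linarith+
      also have "\<dots> \<le> real (j * ?q) * (1 / real l)" using j(2) by (simp add: mult.commute)
      finally show ?thesis .
    qed
    then show ?thesis using E by blast
  qed
  then show ?thesis using j(1) by (intro exI[of _ "j * ?q"]) auto
qed

text \<open>The new period is taken so long that the rewritten sites have density at most
  \<open>b\<close>; the word then determines the window \<open>N\<close>, and the new budget is
  chosen last.\<close>

lemma stage_extend:
  fixes l e :: nat
  assumes w: "periodic_with (2 ^ e) w" "\<And>i. w i = 2 \<or> w i = - 2" and l: "1 \<le> l" and b: "0 < b"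
  shows "\<exists>e' w' \<beta>' N'. stage l e' w' \<beta>' N' \<and> e \<le> e' \<and> real (4 * l) / 2 ^ e' \<le> b \<and> \<beta>' \<le> b \<and>
     (\<forall>i. i mod 2 ^ e' < 2 ^ e' - 4 * int l \<longrightarrow> w' i = w i)"
proof -
  obtain n :: nat where n: "real (4 * l) / b + real (4 * l) < real n" using reals_Archimedean2 by blast
  define e' where "e' = e + n"
  have "n < 2 ^ n" by (rule less_exp)
  also have "(2::nat) ^ n \<le> 2 ^ e'" by (simp add: e'_def)
  finally have "real n < 2 ^ e'" by (metis of_nat_less_iff of_nat_numeral of_nat_power)
  with n have big: "real (4 * l) / b + real (4 * l) < 2 ^ e'" by linarith
  have bl: "real (4 * l) / b > 0" using b l by simp
  have l4: "4 * l < 2 ^ e'"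
  proof -
    have "real (4 * l) < real (2 ^ e')" using big bl by simp
    then show ?thesis by (simp only: of_nat_less_iff)
  qed
  have lb: "real (4 * l) / 2 ^ e' \<le> b"
  proof -
    have "real (4 * l) / b \<le> 2 ^ e'" using big l by linarith
    then show ?thesis using b by (simp add: field_simps)
  qed
  let ?q = "2 ^ e' :: int"
  have q: "4 * int l < ?q" using l4 by (metis of_nat_less_iff of_nat_mult of_nat_numeral of_nat_power)
  define w' where "w' i = (if i mod ?q < ?q - 4 * int l then w i else if i mod ?q < ?q - 2 * int l then 2 else - 2)" for i
  have "periodic_with ?q w"
    by (rule periodic_with_dvd[OF w(1)]) (simp add: e'_def le_imp_power_dvd)
  then have pw': "periodic_with ?q w'" by (simp add: periodic_with_def w'_def)
  have two: "w' i = 2 \<or> w' i = - 2" for i using w(2) by (auto simp: w'_def)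
  have plus: "w' i = 2" if "?q - 4 * int l \<le> i" "i < ?q - 2 * int l" for i
  proof -
    have "i mod ?q = i" using that q by (intro mod_pos_pos_trivial) auto
    then show ?thesis using that by (simp add: w'_def)
  qed
  have minus: "w' i = - 2" if "?q - 2 * int l \<le> i" "i < ?q" for i
  proof -
    have "i mod ?q = i" using that q by (intro mod_pos_pos_trivial) auto
    then show ?thesis using that by (simp add: w'_def)
  qed
  obtain N where N: "N \<ge> 1" "\<forall>E0\<in>{-4..4}. \<exists>E. \<bar>E - E0\<bar> \<le> 4 / sqrt (real l) \<and>
        (\<forall>t. ln (onorm ((*v) (transfer_matrix N E (\<lambda>i. w' (i + t))))) \<le> real N * (1 / real l))"
    using stage_energies[OF pw' two l l4 plus minus] by blast
  \<comment> \<open>The three terms respect the given budget, make disturbed windows of length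
    \<open>N\<close> rare, and let a patch survive with positive probability; \<open>8 * l\<close>
    in place of \<open>4 * l\<close> makes the last inequality strict.\<close>
  define \<beta> where "\<beta> = min b (min (1 / real l / real N) (1 / 2 ^ e' / real (8 * l)))"
  have \<beta>: "0 < \<beta>" "\<beta> \<le> b" using b l N(1) by (auto simp: \<beta>_def)
  have "real N * \<beta> \<le> real N * (1 / real l / real N)"
    by (intro mult_left_mono) (auto simp: \<beta>_def)
  then have b1: "real N * \<beta> \<le> 1 / real l" using N(1) by simp
  have "real (8 * l) * \<beta> \<le> real (8 * l) * (1 / 2 ^ e' / real (8 * l))"
    by (intro mult_left_mono) (auto simp: \<beta>_def)
  then have "real (8 * l) * \<beta> \<le> 1 / 2 ^ e'" using l by simp
  moreover have "real (4 * l) * \<beta> < real (8 * l) * \<beta>" using l \<beta>(1) by simp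
  ultimately have b2: "real (4 * l) * \<beta> < 1 / 2 ^ e'" by linarith
  have "stage l e' w' \<beta> N"
    unfolding stage_def using pw' two l4 plus minus \<beta>(1) N b1 b2 by blast
  moreover have "\<forall>i. i mod ?q < ?q - 4 * int l \<longrightarrow> w' i = w i" by (simp add: w'_def)
  ultimately show ?thesis using lb \<beta>(2) by (intro exI[of _ e'] exI[of _ w'] exI[of _ \<beta>] exI[of _ N]) (auto simp: e'_def)
qed

text \<open>Stage \<open>k\<close> uses the length \<open>Suc k\<close>. One half of the budget
  \<open>\<beta> k\<close> pays for the sites rewritten at the next stage, the other half bounds the
  budget for everything after it.\<close>

lemma stage_sequence:
  "\<exists>(e :: nat \<Rightarrow> nat) w \<beta> N. \<forall>k. stage (Suc k) (e k) (w k) (\<beta> k) (N k) \<and>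
     e k \<le> e (Suc k) \<and> real (4 * Suc (Suc k)) / 2 ^ e (Suc k) \<le> \<beta> k / 2 \<and> \<beta> (Suc k) \<le> \<beta> k / 2 \<and>
     (\<forall>i. i mod 2 ^ e (Suc k) < 2 ^ e (Suc k) - 4 * int (Suc (Suc k)) \<longrightarrow> w (Suc k) i = w k i)"
proof -
  define P where "P k s = (case s of (e, w, \<beta>, N) \<Rightarrow> stage (Suc k) e w \<beta> N)" for k s
  define Q where "Q k s s' = (case s of (e, w, \<beta>, N) \<Rightarrow> case s' of (e', w', \<beta>', N') \<Rightarrow>
     e \<le> e' \<and> real (4 * Suc (Suc k)) / 2 ^ e' \<le> \<beta> / 2 \<and> \<beta>' \<le> \<beta> / 2 \<and>
     (\<forall>i. i mod 2 ^ e' < 2 ^ e' - 4 * int (Suc (Suc k)) \<longrightarrow> w' i = w i))"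
    for k and s s' :: "nat \<times> (int \<Rightarrow> real) \<times> real \<times> nat"
  have "\<exists>s. \<forall>k. P k (s k) \<and> Q k (s k) (s (Suc k))"
  proof (rule dependent_nat_choice)
    have "\<exists>e' w' \<beta>' N'. stage (Suc 0) e' w' \<beta>' N'"
      using stage_extend[of 0 "\<lambda>_. 2" "Suc 0" 1] by (auto simp: periodic_with_def)
    then show "\<exists>s. P 0 s" by (auto simp: P_def)
  next
    fix s k assume s: "P k s"
    obtain e w \<beta> N where seq: "s = (e, w, \<beta>, N)" by (metis prod_cases4)
    have st: "stage (Suc k) e w \<beta> N" using s by (simp add: P_def seq)
    then have w: "periodic_with (2 ^ e) w" "\<And>i. w i = 2 \<or> w i = - 2" "0 < \<beta> / 2"
      unfolding stage_def by auto
    obtain e' w' \<beta>' N' where "stage (Suc (Suc k)) e' w' \<beta>' N'" "e \<le> e'"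
        "real (4 * Suc (Suc k)) / 2 ^ e' \<le> \<beta> / 2" "\<beta>' \<le> \<beta> / 2"
        "\<forall>i. i mod 2 ^ e' < 2 ^ e' - 4 * int (Suc (Suc k)) \<longrightarrow> w' i = w i"
      using stage_extend[OF w(1,2) _ w(3), of "Suc (Suc k)"] by auto
    then show "\<exists>s'. P (Suc k) s' \<and> Q k s s'"
      by (intro exI[of _ "(e', w', \<beta>', N')"]) (simp add: P_def Q_def seq)
  qed
  then obtain s where s: "\<And>k. P k (s k)" "\<And>k. Q k (s k) (s (Suc k))" by blast
  show ?thesis
    by (rule exI[of _ "\<lambda>k. fst (s k)"], rule exI[of _ "\<lambda>k. fst (snd (s k))"],
        rule exI[of _ "\<lambda>k. fst (snd (snd (s k)))"], rule exI[of _ "\<lambda>k. snd (snd (snd (s k)))"])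
      (use s in \<open>simp add: P_def Q_def split_beta\<close>)
qed

section \<open>Two-valued sequences with arbitrarily long patches\<close>

definition seq_algebra :: "(int \<Rightarrow> real) measure" where
  "seq_algebra = PiM UNIV (\<lambda>_. borel)"

definition has_patch :: "real \<Rightarrow> nat \<Rightarrow> (int \<Rightarrow> real) set" where
  "has_patch c l = {\<omega>. \<exists>a. \<forall>i. a \<le> i \<and> i < a + int l \<longrightarrow> \<omega> i = c}"

text \<open>The spectral inclusion is required at every point, not almost every one. This
  shift-invariant measurable set consists of sequences for which it certainly holds, and it will be
  the whole space.\<close>

definition patchy :: "(int \<Rightarrow> real) set" where
  "patchy = {\<omega>. \<forall>n. \<omega> n = 2 \<or> \<omega> n = - 2} \<inter> (\<Inter>l. has_patch 2 l \<inter> has_patch (- 2) l)"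

lemma space_seq_algebra [simp]: "space seq_algebra = UNIV"
  by (simp add: seq_algebra_def space_PiM)

lemma measurable_eval_seq [measurable]: "(\<lambda>\<omega>. \<omega> n) \<in> borel_measurable seq_algebra"
  unfolding seq_algebra_def by (rule measurable_component_singleton) simp

lemma measurable_into_seq_algebra:
  "(\<And>n. (\<lambda>x. g x n) \<in> borel_measurable M) \<Longrightarrow> g \<in> measurable M seq_algebra"
  unfolding seq_algebra_def by (rule measurable_PiM_single') auto

lemma sets_has_patch [measurable]: "has_patch c l \<in> sets seq_algebra"
proof -
  have "{\<omega> \<in> space seq_algebra. \<exists>a. \<forall>i. a \<le> i \<and> i < a + int l \<longrightarrow> \<omega> i = c} \<in> sets seq_algebra"
    by measurable
  then show ?thesis by (simp add: has_patch_def)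
qed

lemma sets_patchy [measurable]: "patchy \<in> sets seq_algebra"
proof -
  have "{\<omega> \<in> space seq_algebra. \<forall>n. \<omega> n = 2 \<or> \<omega> n = - 2} \<in> sets seq_algebra"
    by measurable
  then show ?thesis unfolding patchy_def by (simp add: sets.Int sets.countable_INT)
qed

lemma has_patch_shift: "seq_shift \<omega> \<in> has_patch c l \<longleftrightarrow> \<omega> \<in> has_patch c l"
proof
  assume "\<omega> \<in> has_patch c l"
  then obtain a where "\<And>i. a \<le> i \<Longrightarrow> i < a + int l \<Longrightarrow> \<omega> i = c" by (auto simp: has_patch_def)
  then show "seq_shift \<omega> \<in> has_patch c l"
    unfolding has_patch_def seq_shift_def by (auto intro!: exI[of _ "a - 1"])
next
  assume "seq_shift \<omega> \<in> has_patch c l"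
  then obtain a where "\<And>i. a \<le> i \<Longrightarrow> i < a + int l \<Longrightarrow> \<omega> (i + 1) = c" by (auto simp: has_patch_def seq_shift_def)
  then have "\<omega> i = c" if "a + 1 \<le> i" "i < a + 1 + int l" for i
    using that by (metis add_le_cancel_right add_less_cancel_right diff_add_cancel add.assoc add.commute)
  then show "\<omega> \<in> has_patch c l" by (auto simp: has_patch_def)
qed

lemma patchy_shift: "seq_shift \<omega> \<in> patchy \<longleftrightarrow> \<omega> \<in> patchy"
proof -
  have "(\<forall>n. seq_shift \<omega> n = 2 \<or> seq_shift \<omega> n = - 2) \<longleftrightarrow> (\<forall>n. \<omega> n = 2 \<or> \<omega> n = - 2)"
    unfolding seq_shift_def by (metis diff_add_cancel)
  then show ?thesis by (simp add: patchy_def has_patch_shift)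
qed

lemma unshift_patchy: "\<omega> \<in> patchy \<Longrightarrow> (\<lambda>i. \<omega> (i + (- 1))) \<in> patchy"
  using patchy_shift[of "\<lambda>i. \<omega> (i + (- 1))"] by (simp add: seq_shift_def)

lemma bij_shift_patchy: "bij_betw seq_shift patchy patchy"
  by (rule bij_betw_byWitness[of _ "\<lambda>\<omega> i. \<omega> (i + (- 1))"])
    (use unshift_patchy patchy_shift in \<open>auto simp: seq_shift_def\<close>)

lemma spectrum_patchy:
  assumes "\<omega> \<in> patchy" "E \<in> {-4..4}"
  shows "complex_of_real E \<in> ell2_spectrum (schroedinger \<omega>)"
proof -
  define c :: real where "c = (if E \<ge> 0 then 2 else - 2)"
  have "cos (arccos ((E - c) / 2)) = (E - c) / 2"
    using assms(2) by (intro cos_arccos) (auto simp: c_def)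
  then have E: "c + 2 * cos (arccos ((E - c) / 2)) = E" by simp
  have "\<exists>a. \<forall>i. a \<le> i \<and> i < a + int l \<longrightarrow> \<omega> i = c" for l
    using assms(1) by (auto simp: patchy_def has_patch_def c_def)
  then have "complex_of_real (c + 2 * cos (arccos ((E - c) / 2))) \<in> ell2_spectrum (schroedinger \<omega>)"
    by (rule schroedinger_spectrum_if_long_patches)
  then show ?thesis unfolding E .
qed

locale hierarchy =
  fixes e :: "nat \<Rightarrow> nat" and w :: "nat \<Rightarrow> int \<Rightarrow> real" and \<beta> :: "nat \<Rightarrow> real" and N :: "nat \<Rightarrow> nat"
  assumes stage: "\<And>k. stage (Suc k) (e k) (w k) (\<beta> k) (N k)"
    and e_mono: "\<And>k. e k \<le> e (Suc k)"
    and patch_small: "\<And>k. real (4 * Suc (Suc k)) / 2 ^ e (Suc k) \<le> \<beta> k / 2"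
    and \<beta>_halved: "\<And>k. \<beta> (Suc k) \<le> \<beta> k / 2"
    and w_extends: "\<And>k i. i mod 2 ^ e (Suc k) < 2 ^ e (Suc k) - 4 * int (Suc (Suc k)) \<Longrightarrow> w (Suc k) i = w k i"
begin

lemma
  shows periodic_w: "periodic_with (2 ^ e k) (w k)"
    and w_values: "\<And>i. w k i = 2 \<or> w k i = - 2"
    and patch_less: "4 * Suc k < 2 ^ e k"
    and w_plus: "\<And>i. 2 ^ e k - 4 * int (Suc k) \<le> i \<Longrightarrow> i < 2 ^ e k - 2 * int (Suc k) \<Longrightarrow> w k i = 2"
    and w_minus: "\<And>i. 2 ^ e k - 2 * int (Suc k) \<le> i \<Longrightarrow> i < 2 ^ e k \<Longrightarrow> w k i = - 2"
    and N_pos: "1 \<le> N k"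
    and N_\<beta>: "real (N k) * \<beta> k \<le> 1 / real (Suc k)"
    and patch_\<beta>: "real (4 * Suc k) * \<beta> k < 1 / 2 ^ e k"
    and slow_energies: "\<And>E0. E0 \<in> {-4..4} \<Longrightarrow> \<exists>E. \<bar>E - E0\<bar> \<le> 4 / sqrt (real (Suc k)) \<and>
        (\<forall>t. ln (onorm ((*v) (transfer_matrix (N k) E (\<lambda>i. w k (i + t))))) \<le> real (N k) * (1 / real (Suc k)))"
proof -
  note s = stage[of k, unfolded stage_def]
  from s show "periodic_with (2 ^ e k) (w k)" by (elim conjE)
  from s show "w k i = 2 \<or> w k i = - 2" for i by (elim conjE) (erule spec)
  from s show "4 * Suc k < 2 ^ e k" by (elim conjE)
  have "\<forall>i. 2 ^ e k - 4 * int (Suc k) \<le> i \<and> i < 2 ^ e k - 2 * int (Suc k) \<longrightarrow> w k i = 2"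
    using s by (elim conjE)
  then show "w k i = 2" if "2 ^ e k - 4 * int (Suc k) \<le> i" "i < 2 ^ e k - 2 * int (Suc k)" for i
    using that by blast
  have "\<forall>i. 2 ^ e k - 2 * int (Suc k) \<le> i \<and> i < 2 ^ e k \<longrightarrow> w k i = - 2"
    using s by (elim conjE)
  then show "w k i = - 2" if "2 ^ e k - 2 * int (Suc k) \<le> i" "i < 2 ^ e k" for i
    using that by blast
  from s show "1 \<le> N k" by (elim conjE)
  from s show "real (N k) * \<beta> k \<le> 1 / real (Suc k)" by (elim conjE)
  from s show "real (4 * Suc k) * \<beta> k < 1 / 2 ^ e k" by (elim conjE)
  have "\<forall>E0\<in>{-4..4}. \<exists>E. \<bar>E - E0\<bar> \<le> 4 / sqrt (real (Suc k)) \<and>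
        (\<forall>t. ln (onorm ((*v) (transfer_matrix (N k) E (\<lambda>i. w k (i + t))))) \<le> real (N k) * (1 / real (Suc k)))"
    using s by (elim conjE)
  then show "\<exists>E. \<bar>E - E0\<bar> \<le> 4 / sqrt (real (Suc k)) \<and>
        (\<forall>t. ln (onorm ((*v) (transfer_matrix (N k) E (\<lambda>i. w k (i + t))))) \<le> real (N k) * (1 / real (Suc k)))"
    if "E0 \<in> {-4..4}" for E0
    using that by (rule bspec)
qed

section \<open>The limit potential along odometer orbits\<close>

definition orbit_word :: "nat \<Rightarrow> (nat \<Rightarrow> bool) \<Rightarrow> int \<Rightarrow> real" where
  "orbit_word k x n = w k (int (residue (e k) x) + n)"

text \<open>Shifting the residue rather than iterating the odometer defines the potential at negative sites
  without an inverse of the odometer.\<close>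
definition potential_of :: "(nat \<Rightarrow> bool) \<Rightarrow> int \<Rightarrow> real" where
  "potential_of x n = (if eventually (\<lambda>k. orbit_word k x n = 2) sequentially then 2 else - 2)"

text \<open>The points whose site \<open>0\<close> lies in the block of patches written at stage
  \<open>k\<close>. The subtraction does not truncate, by \<open>patch_less\<close>.\<close>

definition modified :: "nat \<Rightarrow> (nat \<Rightarrow> bool) set" where
  "modified k = {x. 2 ^ e k - 4 * Suc k \<le> residue (e k) x}"

lemma orbit_word_odometer_funpow: "orbit_word k ((odometer ^^ m) x) n = orbit_word k x (n + int m)"
proof -
  have "int (residue (e k) ((odometer ^^ m) x)) = (int (residue (e k) x) + int m) mod 2 ^ e k"
    by (simp add: residue_odometer_funpow zmod_int)
  then have "orbit_word k ((odometer ^^ m) x) n = w k ((int (residue (e k) x) + int m) mod 2 ^ e k + n)"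
    by (simp add: orbit_word_def)
  also have "\<dots> = w k (((int (residue (e k) x) + int m) mod 2 ^ e k + n) mod 2 ^ e k)"
    by (rule periodic_with_mod[OF periodic_w, symmetric])
  also have "\<dots> = w k ((int (residue (e k) x) + (n + int m)) mod 2 ^ e k)"
    by (simp only: mod_add_left_eq add.assoc add.commute[of "int m"])
  also have "\<dots> = orbit_word k x (n + int m)"
    unfolding orbit_word_def by (rule periodic_with_mod[OF periodic_w])
  finally show ?thesis .
qed

lemma potential_of_odometer: "potential_of (odometer x) = seq_shift (potential_of x)"
proof
  fix n
  have "orbit_word k (odometer x) n = orbit_word k x (n + 1)" for k
    using orbit_word_odometer_funpow[of k 1 x n] by simp
  then show "potential_of (odometer x) n = seq_shift (potential_of x) n"
    by (simp only: potential_of_def seq_shift_def)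
qed

text \<open>Outside the new patches the two words agree, and the finer residue reduces to the
  coarser one because the periods divide each other. Site \<open>0\<close> is enough: other
  nonnegative sites are brought there by the odometer.\<close>

lemma orbit_word_Suc:
  assumes "x \<notin> modified (Suc k)"
  shows "orbit_word (Suc k) x 0 = orbit_word k x 0"
proof -
  let ?r = "residue (e (Suc k)) x"
  have "?r < 2 ^ e (Suc k) - 4 * Suc (Suc k)" using assms by (simp add: modified_def not_le)
  then have "int ?r < int (2 ^ e (Suc k) - 4 * Suc (Suc k))" by (simp only: of_nat_less_iff)
  also have "\<dots> = 2 ^ e (Suc k) - 4 * int (Suc (Suc k))"
    using patch_less[of "Suc k"] by (simp add: of_nat_diff)
  finally have lt: "int ?r < 2 ^ e (Suc k) - 4 * int (Suc (Suc k))" .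
  then have "int ?r mod 2 ^ e (Suc k) = int ?r"
    using residue_less[of "e (Suc k)" x] by (metis mod_less of_nat_mod of_nat_numeral of_nat_power)
  then have "w (Suc k) (int ?r) = w k (int ?r)" using w_extends[of "int ?r" k] lt by simp
  also have "\<dots> = w k (int ?r mod 2 ^ e k)" by (rule periodic_with_mod[OF periodic_w, symmetric])
  also have "int ?r mod 2 ^ e k = int (residue (e k) x)"
    unfolding residue_mod[OF e_mono[of k], of x, symmetric] by (simp add: zmod_int)
  finally show ?thesis by (simp add: orbit_word_def)
qed

lemma potential_of_0:
  assumes "\<And>j. k < j \<Longrightarrow> x \<notin> modified j"
  shows "potential_of x 0 = orbit_word k x 0"
proof -
  have "orbit_word j x 0 = orbit_word k x 0" if "k \<le> j" for j
    using that by (induction j rule: dec_induct) (auto simp: orbit_word_Suc assms)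
  then have "eventually (\<lambda>j. orbit_word j x 0 = orbit_word k x 0) sequentially"
    by (rule eventually_sequentiallyI)
  then have "eventually (\<lambda>j. orbit_word j x 0 = 2 \<longleftrightarrow> orbit_word k x 0 = 2) sequentially"
    by eventually_elim simp
  then have "eventually (\<lambda>j. orbit_word j x 0 = 2) sequentially \<longleftrightarrow> eventually (\<lambda>j. orbit_word k x 0 = 2) sequentially"
    by (rule eventually_subst)
  then show ?thesis
    using w_values[of k "int (residue (e k) x)"] by (auto simp: potential_of_def orbit_word_def)
qed

lemma potential_of_window:
  assumes "\<And>j. k < j \<Longrightarrow> (odometer ^^ n) x \<notin> modified j"
  shows "potential_of x (int n) = orbit_word k x (int n)"
proof -
  have "potential_of ((odometer ^^ m) x) = (\<lambda>i. potential_of x (i + int m))" for m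
    by (induction m) (simp_all add: potential_of_odometer seq_shift_def fun_eq_iff algebra_simps)
  then have "potential_of x (int n) = potential_of ((odometer ^^ n) x) 0" by simp
  also have "\<dots> = orbit_word k ((odometer ^^ n) x) 0" by (rule potential_of_0[OF assms])
  finally show ?thesis by (simp add: orbit_word_odometer_funpow)
qed

lemma modified_eq: "modified k = (\<Union>r\<in>{2 ^ e k - 4 * Suc k..<2 ^ e k}. residue_class (e k) r)"
  using residue_less[of "e k"] by (auto simp: modified_def residue_class_def)

lemma sets_modified [measurable]: "modified k \<in> sets coin_space"
  unfolding modified_eq by (intro sets.finite_UN) auto

lemma prob_modified: "measure coin_space (modified k) = real (4 * Suc k) / 2 ^ e k"
proof -
  have "measure coin_space (modified k) = (\<Sum>r\<in>{2 ^ e k - 4 * Suc k..<2 ^ e k}. measure coin_space (residue_class (e k) r))"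
    unfolding modified_eq
  proof (rule coin.finite_measure_finite_Union)
    show "disjoint_family_on (residue_class (e k)) {2 ^ e k - 4 * Suc k..<2 ^ e k}"
      by (auto simp: disjoint_family_on_def residue_class_def)
  qed auto
  also have "\<dots> = (\<Sum>r\<in>{2 ^ e k - 4 * Suc k..<2 ^ e k}. 1 / 2 ^ e k)"
    by (intro sum.cong refl prob_residue_class) auto
  also have "\<dots> = real (2 ^ e k - (2 ^ e k - 4 * Suc k)) * (1 / 2 ^ e k)"
    by simp
  also have "2 ^ e k - (2 ^ e k - 4 * Suc k) = 4 * Suc k" using patch_less[of k] by (intro diff_diff_cancel) simp
  finally show ?thesis by simp
qed

lemma \<beta>_geometric: "\<beta> (k + i) \<le> \<beta> k / 2 ^ i"
proof (induction i)
  case (Suc i)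
  then have "\<beta> (k + i) / 2 \<le> \<beta> k / 2 ^ i / 2" by (intro divide_right_mono) auto
  then show ?case using \<beta>_halved[of "k + i"] by (simp add: mult.commute)
qed simp

text \<open>Some site among the first \<open>m\<close> is rewritten after stage \<open>k\<close>;
  off this set the window is a piece of \<open>w k\<close>.\<close>

definition disturbed :: "nat \<Rightarrow> nat \<Rightarrow> (nat \<Rightarrow> bool) set" where
  "disturbed k m = (\<Union>n<m. \<Union>i. (odometer ^^ n) -` modified (Suc k + i))"

lemma sets_disturbed [measurable]: "disturbed k m \<in> sets coin_space"
  unfolding disturbed_def
  by (intro sets.finite_UN sets.countable_UN) (auto simp del: funpow.simps)

text \<open>Per site, stage \<open>k + 1 + i\<close> costs at most
  \<open>\<beta> (k + i) / 2\<close>, hence at most \<open>\<beta> k / 2 ^ (i + 1)\<close>, and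
  these costs sum to \<open>\<beta> k\<close>.\<close>

lemma prob_disturbed_le: "measure coin_space (disturbed k m) \<le> real m * \<beta> k"
proof -
  have one: "measure coin_space (\<Union>i. (odometer ^^ n) -` modified (Suc k + i)) \<le> \<beta> k" for n
  proof -
    have bound: "measure coin_space ((odometer ^^ n) -` modified (Suc k + i)) \<le> \<beta> k * (1 / 2) ^ Suc i" for i
    proof -
      have "measure coin_space ((odometer ^^ n) -` modified (Suc k + i)) \<le> \<beta> (k + i) / 2"
        using patch_small[of "k + i"] by (subst prob_odometer_funpow_vimage) (simp_all add: prob_modified)
      also have "\<dots> \<le> \<beta> k * (1 / 2) ^ Suc i"
        using \<beta>_geometric[of k i] by (simp add: power_divide)
      finally show ?thesis .
    qed
    have sums: "(\<lambda>i. \<beta> k * (1 / 2) ^ Suc i) sums (\<beta> k * 1)"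
      by (intro sums_mult power_half_series)
    have summ: "summable (\<lambda>i. measure coin_space ((odometer ^^ n) -` modified (Suc k + i)))"
      using bound by (intro summable_comparison_test'[OF sums_summable[OF sums]]) auto
    have "measure coin_space (\<Union>i. (odometer ^^ n) -` modified (Suc k + i))
        \<le> (\<Sum>i. measure coin_space ((odometer ^^ n) -` modified (Suc k + i)))"
      by (intro coin.finite_measure_subadditive_countably summ) auto
    also have "\<dots> \<le> (\<Sum>i. \<beta> k * (1 / 2) ^ Suc i)"
      by (intro suminf_le bound summ sums_summable[OF sums])
    also have "\<dots> = \<beta> k" using sums_unique[OF sums] by simp
    finally show ?thesis .
  qed
  have "measure coin_space (disturbed k m) \<le> (\<Sum>n<m. measure coin_space (\<Union>i. (odometer ^^ n) -` modified (Suc k + i)))"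
    unfolding disturbed_def by (intro coin.finite_measure_subadditive_finite) auto
  also have "\<dots> \<le> (\<Sum>n<m. \<beta> k)" by (intro sum_mono one)
  finally show ?thesis by simp
qed

lemma potential_of_undisturbed:
  assumes "x \<notin> disturbed k m" "n < m"
  shows "potential_of x (int n) = w k (int n + int (residue (e k) x))"
proof -
  have "(odometer ^^ n) x \<notin> modified j" if j: "k < j" for j
  proof -
    obtain i where "j = Suc k + i" using less_imp_Suc_add[OF j] by auto
    then show ?thesis using assms by (auto simp: disturbed_def)
  qed
  then show ?thesis
    by (subst potential_of_window) (auto simp: orbit_word_def add.commute)
qed

lemma measurable_potential_of [measurable]: "potential_of \<in> measurable coin_space seq_algebra"
proof (rule measurable_into_seq_algebra)
  fix n
  have res: "residue k \<in> measurable coin_space (count_space UNIV)" for k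
  proof (subst measurable_count_space_eq2_countable, intro conjI ballI)
    show "residue k -` {r} \<inter> space coin_space \<in> sets coin_space" for r
      using sets_residue_class[of k r] by (simp add: residue_class_def vimage_def)
  qed auto
  have "(\<lambda>x. orbit_word k x n) \<in> borel_measurable coin_space" for k
    unfolding orbit_word_def by (rule measurable_compose[OF res]) simp
  then show "(\<lambda>x. potential_of x n) \<in> borel_measurable coin_space"
    unfolding potential_of_def by measurable
qed

text \<open>A point starting at the block of patches of stage \<open>k\<close> shows both patches
  unless it is disturbed within \<open>4 * Suc k\<close> steps. By \<open>patch_\<beta>\<close> the
  disturbance is less likely than the start, so the event has positive probability; being invariant,
  it has probability 1.\<close>

lemma prob_has_patch:
  assumes "c = 2 \<or> c = - 2"
  shows "measure coin_space (potential_of -` has_patch c l) = 1"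
proof -
  define k where "k = l"
  let ?P = "potential_of -` has_patch c l"
  have P: "?P \<in> sets coin_space"
    using measurable_sets[OF measurable_potential_of sets_has_patch, of c l] by simp
  let ?R = "residue_class (e k) (2 ^ e k - 4 * Suc k)"
  have "?R - disturbed k (4 * Suc k) \<subseteq> ?P"
  proof
    fix x assume x: "x \<in> ?R - disturbed k (4 * Suc k)"
    have r: "int (residue (e k) x) = 2 ^ e k - 4 * int (Suc k)"
      using x patch_less[of k] by (simp add: residue_class_def of_nat_diff)
    have val: "potential_of x n = w k (n + (2 ^ e k - 4 * int (Suc k)))" if "0 \<le> n" "n < 4 * int (Suc k)" for n
      using potential_of_undisturbed[of x k "4 * Suc k" "nat n"] x that r by simp
    \<comment> \<open>Seen from the start of the block, the letters \<open>2\<close> come first and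
      the letters \<open>-2\<close> after them, \<open>2 * Suc k\<close> sites each, which exceeds
      \<open>l\<close>.\<close>
    define a where "a = (if c = 2 then 0 else 2 * int (Suc k))"
    have "potential_of x i = c" if "a \<le> i" "i < a + int l" for i
    proof -
      have i: "0 \<le> i" "i < 4 * int (Suc k)" using that by (auto simp: a_def k_def split: if_splits)
      show ?thesis
      proof (cases "c = 2")
        case True
        then show ?thesis
          unfolding val[OF i] using that by (simp add: a_def k_def w_plus)
      next
        case False
        then show ?thesis
          unfolding val[OF i] using that assms i by (simp add: a_def k_def w_minus)
      qed
    qed
    then show "x \<in> ?P" by (auto simp: has_patch_def)
  qed
  then have "measure coin_space (?R - disturbed k (4 * Suc k)) \<le> measure coin_space ?P"
    using P by (intro coin.finite_measure_mono)
  moreover have "measure coin_space (?R - disturbed k (4 * Suc k))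
      = measure coin_space ?R - measure coin_space (?R \<inter> disturbed k (4 * Suc k))"
    by (rule coin.finite_measure_Diff') auto
  moreover have "measure coin_space (?R \<inter> disturbed k (4 * Suc k)) \<le> measure coin_space (disturbed k (4 * Suc k))"
    by (intro coin.finite_measure_mono) auto
  moreover have "measure coin_space ?R = 1 / 2 ^ e k" by (rule prob_residue_class) simp
  ultimately have "0 < measure coin_space ?P"
    using prob_disturbed_le[of k "4 * Suc k"] patch_\<beta>[of k] by linarith
  moreover have "odometer -` ?P = ?P"
    by (auto simp: potential_of_odometer has_patch_shift)
  ultimately show ?thesis using odometer_ergodic[OF P] by linarith
qed

lemma potential_of_AE_patchy: "AE x in coin_space. potential_of x \<in> patchy"
proof -
  have "AE x in coin_space. potential_of x \<in> has_patch c l" if "c = 2 \<or> c = - 2" for c l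
    using coin.AE_prob_1[OF prob_has_patch[OF that, of l]] by simp
  then have "AE x in coin_space. \<forall>l. potential_of x \<in> has_patch 2 l \<and> potential_of x \<in> has_patch (- 2) l"
    by (auto simp: AE_all_countable)
  then show ?thesis
    by eventually_elim (auto simp: patchy_def potential_of_def)
qed

text \<open>The law of the potential, carried by \<open>patchy\<close>. On sequences the inverse of
  the shift is explicit and the sampling function is the coordinate at \<open>0\<close>.\<close>

definition sequence_measure :: "(int \<Rightarrow> real) measure" where
  "sequence_measure = restrict_space (distr coin_space seq_algebra potential_of) patchy"

lemma space_sequence_measure: "space sequence_measure = patchy"
  by (simp add: sequence_measure_def space_restrict_space)

lemma sets_sequence_measure: "A \<in> sets sequence_measure \<longleftrightarrow> A \<in> sets seq_algebra \<and> A \<subseteq> patchy"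
  unfolding sequence_measure_def by (subst sets_restrict_space_iff) auto

lemma measure_sequence_measure:
  assumes "A \<in> sets sequence_measure"
  shows "measure sequence_measure A = measure coin_space (potential_of -` A)"
proof -
  have A: "A \<in> sets seq_algebra" "A \<subseteq> patchy" using assms by (auto simp: sets_sequence_measure)
  then have "measure sequence_measure A = measure (distr coin_space seq_algebra potential_of) A"
    unfolding sequence_measure_def by (intro measure_restrict_space) auto
  then show ?thesis using A by (simp add: measure_distr)
qed

lemma prob_space_sequence_measure: "prob_space sequence_measure"
proof -
  have "emeasure (distr coin_space seq_algebra potential_of) patchy = emeasure coin_space (potential_of -` patchy)"
    by (simp add: emeasure_distr)
  also have "\<dots> = 1"
  proof (rule coin.emeasure_eq_1_AE)
    show "potential_of -` patchy \<in> sets coin_space"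
      using measurable_sets[OF measurable_potential_of sets_patchy] by simp
  qed (use potential_of_AE_patchy in simp)
  finally show ?thesis
    unfolding sequence_measure_def by (intro prob_space_restrict_space) auto
qed

lemma measurable_eval_sequence [measurable]: "(\<lambda>\<omega>. \<omega> n) \<in> borel_measurable sequence_measure"
  unfolding sequence_measure_def by (rule measurable_restrict_space1) simp

lemma measurable_shift_by:
  assumes "\<And>\<omega>. \<omega> \<in> patchy \<Longrightarrow> (\<lambda>i. \<omega> (i + m)) \<in> patchy"
  shows "(\<lambda>\<omega> i. \<omega> (i + m)) \<in> measurable sequence_measure sequence_measure"
proof -
  have "(\<lambda>\<omega> i. \<omega> (i + m)) \<in> measurable sequence_measure seq_algebra"
    by (rule measurable_into_seq_algebra) simp
  then show "(\<lambda>\<omega> i. \<omega> (i + m)) \<in> measurable sequence_measure sequence_measure"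
    using assms by (subst (2) sequence_measure_def)
      (auto intro!: measurable_restrict_space2 simp: space_sequence_measure)
qed

lemma measurable_shift_sequence: "seq_shift \<in> measurable sequence_measure sequence_measure"
proof -
  have eq: "seq_shift = (\<lambda>\<omega> i. \<omega> (i + 1))" by (simp add: seq_shift_def fun_eq_iff)
  show ?thesis unfolding eq by (rule measurable_shift_by) (use patchy_shift in \<open>simp add: seq_shift_def\<close>)
qed

lemma invertible_shift: "invertible_transformation sequence_measure seq_shift"
  unfolding invertible_transformation_def
proof (intro conjI)
  show "bij_betw seq_shift (space sequence_measure) (space sequence_measure)"
    unfolding space_sequence_measure by (rule bij_shift_patchy)
  have "inv_into patchy seq_shift \<omega> = (\<lambda>i. \<omega> (i + (- 1)))" if "\<omega> \<in> patchy" for \<omega>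
    using bij_shift_patchy unshift_patchy[OF that]
    by (intro inv_into_f_eq) (auto simp: bij_betw_def seq_shift_def)
  then show "inv_into (space sequence_measure) seq_shift \<in> measurable sequence_measure sequence_measure"
    unfolding space_sequence_measure
    by (subst measurable_cong[where g = "\<lambda>\<omega> i. \<omega> (i + (- 1))"])
      (use measurable_shift_by[of "- 1", OF unshift_patchy] in \<open>auto simp: space_sequence_measure\<close>)
qed (rule measurable_shift_sequence)

text \<open>\<open>potential_of\<close> intertwines the odometer with the shift, so the sequence
  space is a factor of the odometer; invariance of the measure and ergodicity pass to
  factors.\<close>

lemma shift_vimage:
  assumes "A \<in> sets sequence_measure"
  shows "potential_of -` (seq_shift -` A \<inter> space sequence_measure) = odometer -` (potential_of -` A)"
proof -
  have "seq_shift -` A \<subseteq> patchy" using assms patchy_shift by (auto simp: sets_sequence_measure)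
  then have "seq_shift -` A \<inter> space sequence_measure = seq_shift -` A"
    by (auto simp: space_sequence_measure)
  then show ?thesis by (simp add: vimage_def potential_of_odometer)
qed

lemma measure_shift_vimage:
  assumes "A \<in> sets sequence_measure"
  shows "measure sequence_measure (seq_shift -` A \<inter> space sequence_measure) = measure sequence_measure A"
proof -
  have "potential_of -` A \<in> sets coin_space"
    using assms measurable_sets[OF measurable_potential_of, of A] by (simp add: sets_sequence_measure)
  then show ?thesis
    using assms measurable_sets[OF measurable_shift_sequence assms]
    by (simp only: measure_sequence_measure shift_vimage measure_odometer_vimage)
qed

lemma ergodic_shift: "ergodic_transformation sequence_measure seq_shift"
  unfolding ergodic_transformation_def
proof (intro conjI ballI impI)
  fix A assume A: "A \<in> sets sequence_measure"
  show "measure sequence_measure (seq_shift -` A \<inter> space sequence_measure) = measure sequence_measure A"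
    using A by (rule measure_shift_vimage)
  assume inv: "seq_shift -` A \<inter> space sequence_measure = A"
  have "potential_of -` A \<in> sets coin_space"
    using A measurable_sets[OF measurable_potential_of, of A] by (simp add: sets_sequence_measure)
  moreover have "odometer -` (potential_of -` A) = potential_of -` A"
    using shift_vimage[OF A] inv by simp
  ultimately show "measure sequence_measure A = 0 \<or> measure sequence_measure A = 1"
    using odometer_ergodic measure_sequence_measure[OF A] by simp
qed (rule measurable_shift_sequence)

sublocale two_valued_shift sequence_measure
proof -
  interpret prob_space sequence_measure by (rule prob_space_sequence_measure)
  show "two_valued_shift sequence_measure"
  proof
    show "distr sequence_measure sequence_measure seq_shift = sequence_measure"
    proof (rule measure_eqI)
      fix A assume "A \<in> sets (distr sequence_measure sequence_measure seq_shift)"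
      then have A: "A \<in> sets sequence_measure" by simp
      then show "emeasure (distr sequence_measure sequence_measure seq_shift) A = emeasure sequence_measure A"
        using measure_shift_vimage[OF A]
        by (simp add: emeasure_distr[OF measurable_shift_sequence] emeasure_eq_measure)
    qed simp
    show "\<omega> n = 2 \<or> \<omega> n = - 2" if "\<omega> \<in> space sequence_measure" for \<omega> n
      using that by (auto simp: space_sequence_measure patchy_def)
  qed (rule measurable_eval_sequence measurable_shift_sequence)+
qed

text \<open>At the slow energy of stage \<open>k\<close>, every window that is a translate of
  \<open>w k\<close> grows slowly; the remaining windows have probability at most
  \<open>N k * \<beta> k \<le> 1 / Suc k\<close>.\<close>

lemma exponent_small:
  assumes "E0 \<in> {-4..4}"
  shows "\<exists>E. \<bar>E - E0\<bar> \<le> 4 / sqrt (real (Suc k)) \<and> exponent E \<le> (1 + ln 12) / real (Suc k)"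
proof -
  obtain E where E: "\<bar>E - E0\<bar> \<le> 4 / sqrt (real (Suc k))"
    "\<And>t. ln (onorm ((*v) (transfer_matrix (N k) E (\<lambda>i. w k (i + t))))) \<le> real (N k) * (1 / real (Suc k))"
    using slow_energies[OF assms, of k] by blast
  have "4 / sqrt (real (Suc k)) \<le> 4" by (simp add: divide_le_eq)
  then have E12: "\<bar>E\<bar> + 4 \<le> 12" using E(1) assms by auto
  \<comment> \<open>Stated through the sequence alone, with a countable quantifier over
    \<open>t\<close>, so that the exceptional set is measurable; its preimage lies in
    \<open>disturbed k (N k)\<close>.\<close>
  define B where "B = {\<omega>\<in>space sequence_measure. \<not> (\<exists>t. \<forall>n<N k. \<omega> (int n) = w k (int n + t))}"
  have B: "B \<in> sets sequence_measure" unfolding B_def by measurable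
  have "exponent E \<le> 1 / real (Suc k) + ln 12 * prob B"
  proof (rule exponent_le_if_mostly_slow[OF N_pos E12 _ B])
    fix \<omega> assume "\<omega> \<in> space sequence_measure - B"
    then obtain t where "\<And>n. n < N k \<Longrightarrow> \<omega> (int n) = w k (int n + t)" by (auto simp: B_def)
    then have "log_growth (N k) E \<omega> = log_growth (N k) E (\<lambda>i. w k (i + t))"
      unfolding log_growth_def by (subst transfer_matrix_cong[of "N k" \<omega> "\<lambda>i. w k (i + t)"]) auto
    then show "log_growth (N k) E \<omega> \<le> real (N k) * (1 / real (Suc k))"
      using E(2)[of t] by (simp add: log_growth_def)
  qed simp
  also have "prob B \<le> 1 / real (Suc k)"
  proof -
    have "potential_of -` B \<subseteq> disturbed k (N k)"
      using potential_of_undisturbed[of _ k "N k"] by (force simp: B_def)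
    then have "prob B \<le> measure coin_space (disturbed k (N k))"
      unfolding measure_sequence_measure[OF B] by (intro coin.finite_measure_mono) auto
    then show ?thesis using prob_disturbed_le[of k "N k"] N_\<beta>[of k] by linarith
  qed
  finally have "exponent E \<le> 1 / real (Suc k) + ln 12 * (1 / real (Suc k))"
    by (simp add: mult_left_mono)
  then show ?thesis using E(1) by (intro exI[of _ E]) (simp add: add_divide_distrib)
qed

lemma exponent_small_near:
  assumes "E0 \<in> {-4<..<4}" "0 < a" "0 < d"
  shows "\<exists>E. \<bar>E - E0\<bar> < d \<and> exponent E < a"
proof -
  have "(\<lambda>k. 4 / sqrt (real (Suc k))) \<longlonglongrightarrow> 0" "(\<lambda>k. (1 + ln 12) / real (Suc k)) \<longlonglongrightarrow> 0"
    by real_asymp+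
  then have "eventually (\<lambda>k. 4 / sqrt (real (Suc k)) < d) sequentially"
    "eventually (\<lambda>k. (1 + ln 12) / real (Suc k) < a) sequentially"
    using assms by (auto dest: order_tendstoD)
  then have "eventually (\<lambda>k. 4 / sqrt (real (Suc k)) < d \<and> (1 + ln 12) / real (Suc k) < a) sequentially"
    by (rule eventually_conj)
  then obtain k where k: "4 / sqrt (real (Suc k)) < d" "(1 + ln 12) / real (Suc k) < a"
    using eventually_happens by force
  have "E0 \<in> {-4..4}" using assms(1) by simp
  from exponent_small[OF this, of k] k show ?thesis by (meson le_less_trans)
qed

lemma potential_shift:
  assumes "\<omega> \<in> patchy"
  shows "potential sequence_measure seq_shift (\<lambda>\<omega>. \<omega> 0) \<omega> = \<omega>"
proof
  fix n :: int
  have inv: "inv_into patchy seq_shift \<omega> = (\<lambda>i. \<omega> (i - 1))" "(\<lambda>i. \<omega> (i - 1)) \<in> patchy" if "\<omega> \<in> patchy" for \<omega>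
    using bij_shift_patchy unshift_patchy[OF that]
    by (auto intro!: inv_into_f_eq simp: bij_betw_def seq_shift_def)
  have "(inv_into patchy seq_shift ^^ m) \<omega> = (\<lambda>i. \<omega> (i - int m)) \<and> (\<lambda>i. \<omega> (i - int m)) \<in> patchy" for m
  proof (induction m)
    case (Suc m)
    then show ?case using inv[of "\<lambda>i. \<omega> (i - int m)"] by (simp add: algebra_simps)
  qed (simp add: assms)
  then show "potential sequence_measure seq_shift (\<lambda>\<omega>. \<omega> 0) \<omega> n = \<omega> n"
    by (simp add: potential_def int_iterate_def seq_shift_funpow space_sequence_measure)
qed

end

theorem corollary1p2:
  shows "\<exists>(M :: (int \<Rightarrow> real) measure) (T :: (int \<Rightarrow> real) \<Rightarrow> (int \<Rightarrow> real)) (f :: (int \<Rightarrow> real) \<Rightarrow> real).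
    prob_space M \<and>
    invertible_transformation M T \<and>
    ergodic_transformation M T \<and>
    f \<in> borel_measurable M \<and>
    bounded (f ` space M) \<and>
    generically_on {-4..4} (\<lambda>E. lyapunov M T f E = 0) \<and>
    (\<forall>\<omega>\<in>space M.
       complex_of_real ` {-4..4} \<subseteq> ell2_spectrum (schroedinger (potential M T f \<omega>))) \<and>
    0 < emeasure lebesgue {E. \<not> isCont (lyapunov M T f) E}"
proof -
  obtain e w \<beta> N where h: "hierarchy e w \<beta> N"
    using stage_sequence unfolding hierarchy_def by blast
  interpret hierarchy e w \<beta> N by (rule h)
  have "bounded ((\<lambda>\<omega>. \<omega> 0) ` space sequence_measure)"
    by (rule bounded_subset[of "{2, - 2}"]) (auto simp: finite_imp_bounded dest: two_valued)
  moreover have "complex_of_real ` {-4..4} \<subseteq> ell2_spectrum (schroedinger (potential sequence_measure seq_shift (\<lambda>\<omega>. \<omega> 0) \<omega>))"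
    if "\<omega> \<in> space sequence_measure" for \<omega>
    using that by (auto simp: space_sequence_measure potential_shift spectrum_patchy)
  ultimately show ?thesis
    using prob_space_sequence_measure invertible_shift ergodic_shift measurable_eval_sequence
      generic_zero_exponent[OF exponent_small_near] exponent_discontinuity[OF exponent_small_near]
    by (intro exI[of _ sequence_measure] exI[of _ seq_shift] exI[of _ "\<lambda>\<omega>. \<omega> 0"]) blast
qed

end
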